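(* Let $\mathcal{B}\subseteq\mathbb{N}$ be a non-empty taut (and hence primitive) set. Then $X_\eta=X_\varphi=\overline{[\varphi_{W'},\varphi]}$.
   Context: $\mathbb{N}=\{1,2,\dots\}$. A set $\mathcal{B}\subseteq\mathbb{N}$ is primitive if there are no distinct $b,b'\in\mathcal{B}$ with $b\mid b'$. For $\mathcal{A}\subseteq\mathbb{N}$ let $\mathcal{M}_{\mathcal{A}}:=\bigcup_{a\in\mathcal{A}}a\mathbb{Z}$, and for $M\subseteq\mathbb{Z}$ let $\underline d(M):=\liminf_{N\to\infty}N^{-1}\operatorname{card}(M\cap[1,N])$. The set $\mathcal{B}$ is taut if $\underline d(\mathcal{M}_{\mathcal{B}\setminus\{b\}})<\underline d(\mathcal{M}_{\mathcal{B}})$ for all $b\in\mathcal{B}$. Let $\Delta:\mathbb{Z}\to\prod_{b\in\mathcal{B}}\mathbb{Z}/b\mathbb{Z}$, $\Delta(n)=(n,n,\dots)$, be the canonical diagonal embedding (the product carries the product topology of discrete finite groups), and let $H:=\overline{\Delta(\mathbb{Z})}$, a compact abelian group. The window is $W:=\{h\in H: h_b\neq 0\ \text{for all } b\in\mathcal{B}\}$, and $W':=\overline{\operatorname{int}(W)}$ (interior and closure in $H$). For $A\subseteq H$ the coding function $\varphi_A:H\to\{0,1\}^{\mathbb{Z}}$ is defined by $\varphi_A(h)(n)=1$ if and only if $h+\Delta(n)\in A$; write $\varphi:=\varphi_W$. Let $\eta:=\varphi(\Delta(0))$ (the characteristic function of $\mathbb{Z}\setminus\mathcal{M}_{\mathcal{B}}$),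 $X_\eta:=\overline{\varphi(\Delta(\mathbb{Z}))}$ (the orbit closure of $\eta$ under the left shift), and $X_\varphi:=\overline{\varphi(H)}$. With $\leqslant$ the coordinatewise order, $[\varphi_{W'},\varphi]:=\{x\in\{0,1\}^{\mathbb{Z}}:\exists h\in H\text{ such that }\varphi_{W'}(h)\leqslant x\leqslant\varphi(h)\}$. *)

theory Defs
  imports "HOL-Analysis.Analysis" "HOL-Algebra.Product_Groups"
begin

definition primitive_set :: "nat set \<Rightarrow> bool" where
  "primitive_set B \<longleftrightarrow> \<not> (\<exists>b\<in>B. \<exists>b'\<in>B. b \<noteq> b' \<and> b dvd b')"

definition multiples :: "nat set \<Rightarrow> int set" where
  "multiples A = (\<Union>a\<in>A. range (\<lambda>k. int a * k))"

definition lower_density :: "int set \<Rightarrow> ereal" where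
  "lower_density M = liminf (\<lambda>N. ereal (real (card (M \<inter> {1..int N})) / real N))"

definition taut :: "nat set \<Rightarrow> bool" where
  "taut B \<longleftrightarrow> (\<forall>b\<in>B. lower_density (multiples (B - {b})) < lower_density (multiples B))"

text \<open>
  The residue group modulo \<open>b\<close> is modelled on the representatives \<open>{0..<b}\<close>,
  with the discrete topology.  Elements of the product are extensional functions on \<open>B\<close>.
  All moduli are assumed positive, since \<^term>\<open>integer_mod_group 0\<close> is the group of integers.
\<close>

definition residue_product :: "nat set \<Rightarrow> (nat \<Rightarrow> int) monoid" where
  "residue_product B = product_group B integer_mod_group"

definition residue_product_topology :: "nat set \<Rightarrow> (nat \<Rightarrow> int) topology" where
  "residue_product_topology B =
     product_topology (\<lambda>b. discrete_topology (carrier (integer_mod_group b))) B"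

definition Delta :: "nat set \<Rightarrow> int \<Rightarrow> nat \<Rightarrow> int" where
  "Delta B n = (\<lambda>b\<in>B. n mod int b)"

definition odometer :: "nat set \<Rightarrow> (nat \<Rightarrow> int) set" where
  "odometer B = residue_product_topology B closure_of range (Delta B)"

definition odometer_topology :: "nat set \<Rightarrow> (nat \<Rightarrow> int) topology" where
  "odometer_topology B = subtopology (residue_product_topology B) (odometer B)"

definition window :: "nat set \<Rightarrow> (nat \<Rightarrow> int) set" where
  "window B = {h \<in> odometer B. \<forall>b\<in>B. h b \<noteq> \<one>\<^bsub>integer_mod_group b\<^esub>}"

definition window' :: "nat set \<Rightarrow> (nat \<Rightarrow> int) set" where
  "window' B = odometer_topology B closure_of (odometer_topology B interior_of window B)"

text \<open>Points of the full shift \<open>{0, 1}\<^sup>\<int>\<close> are functions \<open>int \<Rightarrow> nat\<close> with values in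
  \<open>{0, 1}\<close>, so the coordinatewise order is the library order on functions.\<close>

definition full_shift :: "(int \<Rightarrow> nat) topology" where
  "full_shift = product_topology (\<lambda>_. discrete_topology {0, 1}) UNIV"

definition coding :: "nat set \<Rightarrow> (nat \<Rightarrow> int) set \<Rightarrow> (nat \<Rightarrow> int) \<Rightarrow> int \<Rightarrow> nat" where
  "coding B A h = (\<lambda>n. if h \<otimes>\<^bsub>residue_product B\<^esub> Delta B n \<in> A then 1 else 0)"

definition eta :: "nat set \<Rightarrow> int \<Rightarrow> nat" where
  "eta B = coding B (window B) (Delta B 0)"

definition X_eta :: "nat set \<Rightarrow> (int \<Rightarrow> nat) set" where
  "X_eta B = full_shift closure_of (coding B (window B) ` range (Delta B))"

definition X_phi :: "nat set \<Rightarrow> (int \<Rightarrow> nat) set" where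
  "X_phi B = full_shift closure_of (coding B (window B) ` odometer B)"

definition coding_interval :: "nat set \<Rightarrow> (int \<Rightarrow> nat) set" where
  "coding_interval B = {x \<in> topspace full_shift.
     \<exists>h\<in>odometer B. coding B (window' B) h \<le> x \<and> x \<le> coding B (window B) h}"

lemma Delta_add:
  "Delta B m \<otimes>\<^bsub>residue_product B\<^esub> Delta B n = Delta B (m + n)"
  by (auto simp: Delta_def residue_product_def product_group_def mod_add_eq fun_eq_iff)

lemma Delta_in_odometer:
  assumes "0 \<notin> B"
  shows "Delta B n \<in> odometer B"
proof -
  have "b > 0" if "b \<in> B" for b
    using assms that by (metis gr0I)
  then have "range (Delta B) \<subseteq> topspace (residue_product_topology B)"
    by (auto simp: residue_product_topology_def Delta_def carrier_integer_mod_group)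
  then show ?thesis
    unfolding odometer_def using closure_of_subset by blast
qed

lemma eta_eq:
  assumes "0 \<notin> B"
  shows "eta B n = (if n \<in> multiples B then 0 else 1)"
proof -
  have "eta B n = (if Delta B n \<in> window B then 1 else 0)"
    by (simp add: eta_def coding_def Delta_add)
  moreover have "Delta B n \<in> window B \<longleftrightarrow> (\<forall>b\<in>B. \<not> int b dvd n)"
    using Delta_in_odometer[OF assms, of n] by (simp add: window_def Delta_def dvd_eq_mod_eq_0)
  moreover have "n \<in> multiples B \<longleftrightarrow> (\<exists>b\<in>B. int b dvd n)"
    by (auto simp: multiples_def dvd_def)
  ultimately show ?thesis
    by auto
qed

lemma X_eta_eq_orbit_closure:
  "X_eta B = full_shift closure_of (range (\<lambda>k n. eta B (n + k)))"
proof -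
  have "coding B (window B) (Delta B k) = (\<lambda>n. eta B (n + k))" for k
    by (simp add: fun_eq_iff eta_def coding_def Delta_add add.commute)
  then show ?thesis
    by (simp add: X_eta_def image_image)
qed

end

theory Submission
  imports Defs "HOL-Number_Theory.Totient"
begin

text \<open>
  Call an integer \<^emph>\<open>free\<close> if it is not in \<^term>\<open>multiples B\<close>.  The inclusions
  \<open>X\<^sub>\<eta> \<subseteq> X\<^sub>\<phi> \<subseteq> closure [\<phi>\<^sub>W\<^sub>', \<phi>]\<close> are formal, the second because \<open>W' \<subseteq> W\<close>.  What has to be shown
  is \<open>[\<phi>\<^sub>W\<^sub>', \<phi>] \<subseteq> X\<^sub>\<eta>\<close>, and this is a statement about integers (\<open>realise_pattern\<close>): if
  \<open>h + \<Delta>(n) \<in> W\<close> for \<open>n\<close> in a finite set \<open>P\<close> and \<open>h + \<Delta>(n) \<notin> W'\<close> for \<open>n\<close> in a finite set \<open>Z\<close>, then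
  some integer \<open>k\<close> has \<open>k + n\<close> free for all \<open>n \<in> P\<close> and not free for all \<open>n \<in> Z\<close>.

  \<^emph>\<open>The set \<open>P\<close>.\<close>  Approximate \<open>h\<close> by a residue class modulo \<open>L\<close>, a multiple of many elements of \<open>B\<close>.
  For a single \<open>n\<close>, the members \<open>k\<close> of the class with \<open>k + n\<close> free have positive density: sort the
  \<open>b \<in> B\<close> by their common divisor \<open>g\<close> with the class and divide \<open>g\<close> out.  Since \<open>B\<close> is taut, no
  family of cofactors is a Behrend set, that is, a set whose multiples have density one
  (\<open>taut_sift_density_bounded_below\<close>), and Behrend's inequality puts the families for the
  finitely many \<open>g\<close> together.  To treat all \<open>n \<in> P\<close> at once an analogue of that inequality
  for shifted sets is needed (\<open>shifted_behrend_inequality\<close>).  Its proof looks at one prime \<open>p\<close> at a time.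
  If the shifts are distinct modulo \<open>p\<close>, then \<open>p\<close> affects at most one of the \<open>m = card P\<close> conditions at
  any given integer, and the failure of independence costs only a factor \<open>1 - m\<^sup>2/p\<^sup>2\<close>.  The product of
  these factors over large \<open>p\<close> is bounded away from \<open>0\<close>.  Both inequalities come out of the same induction
  over prime powers (\<open>mean_prod_ge_prod_mean\<close>).

  This bounds densities for finite subsets of \<open>B\<close>, uniformly.  To find an actual integer for
  infinite \<open>B\<close> one needs the theorem of Davenport and Erdos that the elements of \<open>B\<close> outside a large finite
  subset add little lower density.  It follows from Behrend's inequality too, applied to the sets of
  free integers and to the set of integers up to \<open>N\<close>, which is also closed under divisors.

  \<^emph>\<open>The set \<open>Z\<close>.\<close>  Its elements are added one by one (\<open>force_multiple\<close>).  As \<open>h + \<Delta>(n) \<notin> W'\<close>, the window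
  has no interior near \<open>h + \<Delta>(n)\<close>, so every integer \<open>k\<close> near \<open>h\<close> can be moved, within its class modulo \<open>L\<close>,
  to some \<open>k'\<close> with \<open>b dvd k' + n\<close> for some \<open>b \<in> B\<close>.  Fixing this divisibility creates no new obstruction for
  \<open>n' \<in> P\<close>: if \<open>b'\<close> divides \<open>k' + n'\<close>, then \<open>gcd b b'\<close> divides \<open>n - n'\<close> and hence is small, and \<open>L\<close> is
  chosen to be a multiple of all small divisors of elements of \<open>B\<close>.
\<close>

section \<open>Means over residue systems\<close>

definition mean :: "(nat \<Rightarrow> real) \<Rightarrow> nat \<Rightarrow> real" where
  "mean F Q = (\<Sum>x<Q. F x) / real Q"

lemma mean_mono:
  assumes "\<And>x. x < Q \<Longrightarrow> F x \<le> G x"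
  shows "mean F Q \<le> mean G Q"
  unfolding mean_def using assms by (intro divide_right_mono sum_mono) auto

lemma mean_cong:
  assumes "\<And>x. x < Q \<Longrightarrow> F x = G x"
  shows "mean F Q = mean G Q"
  unfolding mean_def using assms by simp

lemma mean_nonneg:
  assumes "\<And>x. x < Q \<Longrightarrow> 0 \<le> F x"
  shows "0 \<le> mean F Q"
  unfolding mean_def using assms by (intro divide_nonneg_nonneg sum_nonneg) auto

lemma mean_cmult: "mean (\<lambda>x. c * F x) Q = c * mean F Q"
  by (simp add: mean_def sum_distrib_left)

lemma mean_const: "Q > 0 \<Longrightarrow> mean (\<lambda>x. c) Q = c"
  by (simp add: mean_def)

lemma mean_diff: "mean (\<lambda>x. F x - G x) Q = mean F Q - mean G Q"
  by (simp add: mean_def sum_subtractf diff_divide_distrib)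

lemma mean_sum: "mean (\<lambda>x. \<Sum>i\<in>I. F i x) Q = (\<Sum>i\<in>I. mean (F i) Q)"
  unfolding mean_def by (subst sum.swap) (simp add: sum_divide_distrib)

lemma sum_periodic:
  fixes F :: "nat \<Rightarrow> real"
  assumes per: "\<And>x. F (x mod Q) = F x"
  shows "(\<Sum>x<k * Q. F x) = real k * (\<Sum>x<Q. F x)"
proof -
  have "(\<Sum>x<k * Q. F x) = (\<Sum>m<k. \<Sum>x\<in>{m * Q..<m * Q + Q}. F x)"
    by (rule sum.nat_group [symmetric])
  also have "\<dots> = (\<Sum>m<k. \<Sum>x<Q. F x)"
  proof (rule sum.cong [OF refl])
    fix m
    have "(\<Sum>x\<in>{m * Q..<m * Q + Q}. F x) = (\<Sum>x\<in>{0..<Q}. F (x + m * Q))"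
      using sum.shift_bounds_nat_ivl [of F 0 "m * Q" Q] by (simp add: add.commute)
    also have "\<dots> = (\<Sum>x<Q. F x)"
    proof (rule sum.cong)
      fix x
      show "F (x + m * Q) = F x"
        using per [of x] per [of "x + m * Q"] by simp
    qed auto
    finally show "(\<Sum>x\<in>{m * Q..<m * Q + Q}. F x) = (\<Sum>x<Q. F x)" .
  qed
  finally show ?thesis by simp
qed

lemma mean_period:
  assumes per: "\<And>x. F (x mod Q) = F x" and "Q dvd Q'" "Q' > 0"
  shows "mean F Q' = mean F Q"
proof -
  obtain k where "Q' = Q * k" using assms(2) by (auto simp: dvd_def)
  then show ?thesis
    using sum_periodic [of F Q k, OF per] assms(3) by (simp add: mean_def mult.commute)
qed

lemma sum_periodic_bounds:
  fixes F :: "nat \<Rightarrow> real"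
  assumes per: "\<And>x. F (x mod Q) = F x" and "Q > 0"
    and F01: "\<And>x. 0 \<le> F x" "\<And>x. F x \<le> 1"
  shows "real N * mean F Q - real Q \<le> (\<Sum>x<N. F x)"
    and "(\<Sum>x<N. F x) \<le> real N * mean F Q + real Q"
proof -
  define k where "k = N div Q"
  have N: "N = k * Q + N mod Q" by (simp add: k_def)
  have m01: "0 \<le> mean F Q" "mean F Q \<le> 1"
    using mean_nonneg [of Q F] mean_mono [of Q F "\<lambda>_. 1"] F01 \<open>Q > 0\<close> by (auto simp: mean_const)
  have ml: "real (N mod Q) \<le> real Q" using \<open>Q > 0\<close> by simp
  have kQ: "(\<Sum>x<k * Q. F x) = real (k * Q) * mean F Q"
    using sum_periodic [of F Q k, OF per] \<open>Q > 0\<close> by (simp add: mean_def)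
  have split: "(\<Sum>x<N. F x) = (\<Sum>x<k * Q. F x) + (\<Sum>x\<in>{k * Q..<N}. F x)"
    using sum.atLeastLessThan_concat [of 0 "k * Q" N F] N by (simp add: lessThan_atLeast0)
  have r0: "0 \<le> (\<Sum>x\<in>{k * Q..<N}. F x)" by (intro sum_nonneg F01)
  have "(\<Sum>x\<in>{k * Q..<N}. F x) \<le> (\<Sum>x\<in>{k * Q..<N}. 1)" by (intro sum_mono F01)
  also have "\<dots> = real (N - k * Q)" by simp
  also have "N - k * Q = N mod Q" using N by simp
  also note ml
  finally have r1: "(\<Sum>x\<in>{k * Q..<N}. F x) \<le> real Q" .
  have rN: "real N = real (k * Q) + real (N mod Q)" using N by (metis of_nat_add)
  have t: "0 \<le> real (N mod Q) * mean F Q" "real (N mod Q) * mean F Q \<le> real Q * 1"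
    using m01 mult_mono [OF ml m01(2)] by simp_all
  show "real N * mean F Q - real Q \<le> (\<Sum>x<N. F x)"
    using split r0 kQ rN t by (simp add: algebra_simps)
  show "(\<Sum>x<N. F x) \<le> real N * mean F Q + real Q"
    using split r1 kQ rN t by (simp add: algebra_simps)
qed

lemma mean_shift:
  assumes per: "\<And>x. F (x mod Q) = F x"
  shows "mean (\<lambda>x. F (x + s)) Q = mean F Q"
proof (cases "Q = 0")
  case False
  have "(\<Sum>x<Q. F (x + s)) = (\<Sum>x<Q. F x)"
  proof (induction s)
    case (Suc s)
    have "(\<Sum>x<Q. F (x + Suc s)) + F (0 + s) = (\<Sum>x<Suc Q. F (x + s))"
      by (subst sum.lessThan_Suc_shift) simp
    also have "\<dots> = (\<Sum>x<Q. F (x + s)) + F (Q + s)" by simp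
    also have "F (Q + s) = F (0 + s)" using per [of "Q + s"] per [of s] by simp
    finally show ?case using Suc by simp
  qed simp
  then show ?thesis by (simp add: mean_def)
qed (simp add: mean_def)

lemma mean_crt:
  assumes "coprime a b" "a > 0" "b > 0"
  shows "mean (\<lambda>x. \<Phi> (x mod a) (x mod b)) (a * b) = mean (\<lambda>y. mean (\<lambda>z. \<Phi> y z) b) a"
proof -
  let ?f = "\<lambda>x. (x mod a, x mod b)"
  have inj: "inj_on ?f {..<a * b}"
  proof (rule inj_onI)
    fix x y assume *: "x \<in> {..<a * b}" "y \<in> {..<a * b}" "?f x = ?f y"
    then have "[x = y] (mod a)" "[x = y] (mod b)" by (auto simp: cong_def)
    then have "[x = y] (mod a * b)" using assms(1) by (simp add: coprime_cong_mult_nat)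
    then show "x = y" using * by (auto simp: cong_def)
  qed
  have "?f ` {..<a * b} \<subseteq> {..<a} \<times> {..<b}" using assms by auto
  moreover have "card (?f ` {..<a * b}) = card ({..<a} \<times> {..<b})"
    using inj by (simp add: card_image)
  ultimately have img: "?f ` {..<a * b} = {..<a} \<times> {..<b}"
    by (intro card_subset_eq) auto
  have "(\<Sum>x<a * b. \<Phi> (x mod a) (x mod b)) = (\<Sum>(y, z)\<in>?f ` {..<a * b}. \<Phi> y z)"
    using inj by (simp add: sum.reindex)
  also have "\<dots> = (\<Sum>y<a. \<Sum>z<b. \<Phi> y z)"
    unfolding img by (simp add: sum.cartesian_product)
  finally show ?thesis by (simp add: mean_def sum_divide_distrib [symmetric] mult.commute)
qed

section \<open>A correlation inequality, one prime at a time\<close>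

definition div_antitone :: "(nat \<Rightarrow> real) \<Rightarrow> bool" where
  "div_antitone f \<longleftrightarrow> (\<forall>d. 0 \<le> f d) \<and> (\<forall>d d'. d dvd d' \<longrightarrow> f d' \<le> f d)"

text \<open>
  The function ignores all primes outside \<open>R\<close>.  Keeping track of this shows which conditions a given prime
  can influence at all.
\<close>
definition blind_outside :: "nat set \<Rightarrow> (nat \<Rightarrow> real) \<Rightarrow> bool" where
  "blind_outside R f \<longleftrightarrow> (\<forall>p d. prime p \<and> p \<notin> R \<longrightarrow> f (p * d) = f d)"

lemma div_antitone_scale: "div_antitone f \<Longrightarrow> div_antitone (\<lambda>t. f (d * t))"
  by (simp add: div_antitone_def)

lemma blind_outside_scale: "blind_outside R f \<Longrightarrow> blind_outside R (\<lambda>t. f (d * t))"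
  by (simp add: blind_outside_def mult.left_commute)

lemma div_antitone_average:
  assumes "div_antitone f"
  shows "div_antitone (\<lambda>d. mean (\<lambda>z. f (d * gcd z q)) q)"
  using assms unfolding div_antitone_def
  by (auto intro!: mean_nonneg mean_mono)

lemma blind_outside_average:
  assumes "blind_outside R f"
  shows "blind_outside R (\<lambda>d. mean (\<lambda>z. f (d * gcd z q)) q)"
  using assms by (simp add: blind_outside_def mult.assoc)

lemma gcd_add_mod: "gcd (x mod Q + s) Q = gcd (x + s) (Q :: nat)"
  by (metis gcd_mod_left gcd_red_nat gcd.commute mod_add_left_eq)

lemma gcd_mult_right_coprime:
  assumes "coprime a (b::nat)"
  shows "gcd x (a * b) = gcd x a * gcd x b"
proof (rule dvd_antisym)
  show "gcd x a * gcd x b dvd gcd x (a * b)"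
    using assms by (intro divides_mult gcd_greatest)
      (auto intro: mult_dvd_mono dvd_mult dvd_mult2 coprime_divisors[of _ a _ b])
  obtain d d' where d: "gcd x (a * b) = d * d'" "d dvd a" "d' dvd b"
    using division_decomp [of "gcd x (a * b)" a b] by auto
  then have "d dvd x" "d' dvd x"
    by (metis dvd_mult_left dvd_mult_right gcd_dvd1)+
  then show "gcd x (a * b) dvd gcd x a * gcd x b"
    using d by (simp add: mult_dvd_mono)
qed

lemma gcd_shift_periodic:
  fixes F :: "nat \<Rightarrow> real"
  shows "F (gcd (x mod Q) Q) = F (gcd x Q)"
  using gcd_add_mod [of x Q 0] by simp

text \<open>
  By the Chinese remainder theorem a uniform residue modulo \<open>Q = Q' * p ^ e\<close> is a pair of independent ones.
  Averaging each function over the component modulo \<open>p ^ e\<close> leaves functions of the component modulo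
  \<open>Q'\<close> that are again antitone and blind to the same primes.  So an inequality known for every single prime
  power, uniformly in the functions, multiplies up.
\<close>
theorem mean_prod_ge_prod_mean:
  fixes f :: "'i \<Rightarrow> nat \<Rightarrow> real" and s :: "'i \<Rightarrow> nat" and c :: "nat \<Rightarrow> real"
  assumes "finite I" "Q > 0"
    and f: "\<And>i. i \<in> I \<Longrightarrow> div_antitone (f i)" "\<And>i. i \<in> I \<Longrightarrow> blind_outside (R i) (f i)"
    and c: "\<And>p. p \<in> prime_factors Q \<Longrightarrow> 0 \<le> c p"
    and one_prime: "\<And>p e u. \<lbrakk>p \<in> prime_factors Q; e > 0;
        \<And>i. i \<in> I \<Longrightarrow> div_antitone (u i); \<And>i. i \<in> I \<Longrightarrow> blind_outside (R i) (u i)\<rbrakk> \<Longrightarrow>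
        c p * (\<Prod>i\<in>I. mean (\<lambda>z. u i (gcd z (p ^ e))) (p ^ e))
          \<le> mean (\<lambda>z. \<Prod>i\<in>I. u i (gcd (z + s i) (p ^ e))) (p ^ e)"
  shows "(\<Prod>p\<in>prime_factors Q. c p) * (\<Prod>i\<in>I. mean (\<lambda>x. f i (gcd x Q)) Q)
          \<le> mean (\<lambda>x. \<Prod>i\<in>I. f i (gcd (x + s i) Q)) Q"
  using \<open>Q > 0\<close> f c one_prime
proof (induction Q arbitrary: f rule: less_induct)
  case (less Q)
  show ?case
  proof (cases "Q = 1")
    case True
    then show ?thesis by (simp add: mean_def)
  next
    case False
    then obtain p where p: "prime p" "p dvd Q" using prime_factor_nat by blast
    define e where "e = multiplicity p Q"
    obtain Q' where Q': "Q = p ^ e * Q'" "\<not> p dvd Q'"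
      unfolding e_def using \<open>Q > 0\<close> p(1) multiplicity_decompose' [of Q p]
      by (metis not_prime_unit not_gr_zero)
    define q where "q = p ^ e"
    have "e > 0" using p Q' by (cases e) auto
    have cop: "coprime Q' q"
      unfolding q_def using prime_imp_coprime [OF p(1) Q'(2)] by (simp add: coprime_commute)
    have QQ: "Q = Q' * q" using Q' by (simp add: q_def)
    have pos: "Q' > 0" "q > 0" using QQ \<open>Q > 0\<close> by auto
    have "q > 1" unfolding q_def using p \<open>e > 0\<close> prime_gt_1_nat one_less_power by blast
    then have "Q' < Q" using QQ pos by simp
    have pfq: "prime_factors q = {p}"
      unfolding q_def using p \<open>e > 0\<close> by (simp add: prime_factors_power prime_prime_factors)
    have pf: "prime_factors Q = insert p (prime_factors Q')"
      using QQ pos pfq by (auto simp: prime_factors_product)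
    have pnotin: "p \<notin> prime_factors Q'" using Q' by auto
    define g where "g = (\<lambda>i d. mean (\<lambda>z. f i (d * gcd z q)) q)"
    have gcdQ: "gcd (x + t) Q = gcd (x mod Q' + t) Q' * gcd (x mod q + t) q" for x t
      unfolding QQ gcd_add_mod using cop by (rule gcd_mult_right_coprime)
    have meang: "mean (\<lambda>x. f i (gcd x Q)) Q = mean (\<lambda>y. g i (gcd y Q')) Q'" if "i \<in> I" for i
    proof -
      have "mean (\<lambda>x. f i (gcd x Q)) Q
            = mean (\<lambda>x. f i (gcd (x mod Q') Q' * gcd (x mod q) q)) (Q' * q)"
        using gcdQ [of _ 0] by (simp add: QQ)
      also have "\<dots> = mean (\<lambda>y. mean (\<lambda>z. f i (gcd y Q' * gcd z q)) q) Q'"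
        by (rule mean_crt [OF cop pos, of "\<lambda>y z. f i (gcd y Q' * gcd z q)"])
      finally show ?thesis by (simp add: g_def)
    qed
    have "(\<Prod>p\<in>prime_factors Q. c p) * (\<Prod>i\<in>I. mean (\<lambda>x. f i (gcd x Q)) Q)
        = c p * ((\<Prod>p\<in>prime_factors Q'. c p) * (\<Prod>i\<in>I. mean (\<lambda>y. g i (gcd y Q')) Q'))"
      using pnotin by (simp add: pf meang mult.assoc)
    also have "\<dots> \<le> c p * mean (\<lambda>y. \<Prod>i\<in>I. g i (gcd (y + s i) Q')) Q'"
    proof (intro mult_left_mono less.IH)
      show "0 \<le> c p" using less.prems pf by simp
      show "div_antitone (g i)" if "i \<in> I" for i
        unfolding g_def using less.prems that by (intro div_antitone_average) auto
      show "blind_outside (R i) (g i)" if "i \<in> I" for i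
        unfolding g_def using less.prems that by (intro blind_outside_average) auto
    qed (use \<open>Q' < Q\<close> pos less.prems pf in auto)
    also have "\<dots> = mean (\<lambda>y. c p * (\<Prod>i\<in>I. g i (gcd (y + s i) Q'))) Q'"
      by (simp add: mean_cmult)
    also have "\<dots> \<le> mean (\<lambda>y. mean (\<lambda>z. \<Prod>i\<in>I. f i (gcd (y + s i) Q' * gcd (z + s i) q)) q) Q'"
    proof (rule mean_mono)
      fix y
      show "c p * (\<Prod>i\<in>I. g i (gcd (y + s i) Q'))
          \<le> mean (\<lambda>z. \<Prod>i\<in>I. f i (gcd (y + s i) Q' * gcd (z + s i) q)) q"
        unfolding g_def q_def
        by (rule less.prems(5) [where u = "\<lambda>i t. f i (gcd (y + s i) Q' * t)"])
           (use less.prems pf \<open>e > 0\<close> in \<open>auto intro: div_antitone_scale blind_outside_scale\<close>)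
    qed
    also have "\<dots> = mean (\<lambda>x. \<Prod>i\<in>I. f i (gcd (x mod Q' + s i) Q' * gcd (x mod q + s i) q)) (Q' * q)"
      by (rule mean_crt [OF cop pos, symmetric,
            of "\<lambda>y z. \<Prod>i\<in>I. f i (gcd (y + s i) Q' * gcd (z + s i) q)"])
    also have "\<dots> = mean (\<lambda>x. \<Prod>i\<in>I. f i (gcd (x + s i) Q)) Q"
      by (simp add: gcdQ QQ [symmetric])
    finally show ?thesis .
  qed
qed

text \<open>Chebyshev's sum inequality, from summing the hypothesis over all pairs.\<close>
lemma mean_mult_ge_of_similarly_ordered:
  assumes "Q > 0" and "\<And>x y. x < Q \<Longrightarrow> y < Q \<Longrightarrow> 0 \<le> (F x - F y) * (G x - G y)"
  shows "mean F Q * mean G Q \<le> mean (\<lambda>x. F x * G x) Q"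
proof -
  have "0 \<le> (\<Sum>x<Q. \<Sum>y<Q. (F x - F y) * (G x - G y))"
    using assms by (intro sum_nonneg) auto
  also have "\<dots> = (\<Sum>x<Q. \<Sum>y<Q. F x * G x) + (\<Sum>x<Q. \<Sum>y<Q. F y * G y)
      - (\<Sum>x<Q. \<Sum>y<Q. F x * G y) - (\<Sum>x<Q. \<Sum>y<Q. F y * G x)"
    unfolding sum.distrib [symmetric] sum_subtractf [symmetric]
    by (intro sum.cong refl) (simp add: algebra_simps)
  also have "(\<Sum>x<Q. \<Sum>y<Q. F y * G x) = (\<Sum>x<Q. \<Sum>y<Q. F x * G y)"
    by (rule sum.swap)
  also have "(\<Sum>x<Q. \<Sum>y<Q. F x * G y) = (\<Sum>x<Q. F x) * (\<Sum>y<Q. G y)"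
    by (simp add: sum_product)
  also have "(\<Sum>x<Q. \<Sum>y<Q. F x * G x) = real Q * (\<Sum>x<Q. F x * G x)"
    by (simp add: sum_distrib_left)
  finally have "(\<Sum>x<Q. F x) * (\<Sum>y<Q. G y) \<le> real Q * (\<Sum>x<Q. F x * G x)"
    by simp
  then show ?thesis
    using \<open>Q > 0\<close> by (simp add: mean_def field_simps)
qed

text \<open>
  Unlike for general shifts, no constant is lost when all shifts vanish: along a single prime
  Chebyshev's inequality applies.
\<close>
theorem behrend_inequality:
  assumes "div_antitone f" "div_antitone g" "Q > 0"
  shows "mean (\<lambda>x. f (gcd x Q)) Q * mean (\<lambda>x. g (gcd x Q)) Q
           \<le> mean (\<lambda>x. f (gcd x Q) * g (gcd x Q)) Q"
proof -
  let ?f = "\<lambda>i. if i then f else g"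
  have "(\<Prod>p\<in>prime_factors Q. 1) * (\<Prod>i\<in>UNIV. mean (\<lambda>x. ?f i (gcd x Q)) Q)
          \<le> mean (\<lambda>x. \<Prod>i\<in>UNIV. ?f i (gcd (x + (\<lambda>_. 0) i) Q)) Q"
  proof (rule mean_prod_ge_prod_mean [where R = "\<lambda>_. UNIV"])
    fix p e :: nat and u :: "bool \<Rightarrow> nat \<Rightarrow> real"
    assume p: "p \<in> prime_factors Q" and "e > 0"
      and u: "\<And>i. i \<in> UNIV \<Longrightarrow> div_antitone (u i)"
    then have "prime p" by auto
    have "mean (\<lambda>z. u True (gcd z (p ^ e))) (p ^ e) * mean (\<lambda>z. u False (gcd z (p ^ e))) (p ^ e)
        \<le> mean (\<lambda>z. u True (gcd z (p ^ e)) * u False (gcd z (p ^ e))) (p ^ e)"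
    proof (rule mean_mult_ge_of_similarly_ordered)
      fix x y
      obtain i j where ij: "gcd x (p ^ e) = p ^ i" "gcd y (p ^ e) = p ^ j"
        using divides_primepow_nat [OF \<open>prime p\<close>] gcd_dvd2 by meson
      \<comment> \<open>Divisors of a prime power form a chain, so both factors order \<open>x\<close> and \<open>y\<close> alike.\<close>
      have "p ^ i dvd p ^ j \<or> p ^ j dvd p ^ i"
        using le_imp_power_dvd nat_le_linear by blast
      then show "0 \<le> (u True (gcd x (p ^ e)) - u True (gcd y (p ^ e))) *
          (u False (gcd x (p ^ e)) - u False (gcd y (p ^ e)))"
        using u [of True] u [of False] unfolding ij div_antitone_def
        by (auto intro: mult_nonneg_nonneg mult_nonpos_nonpos)
    qed (use \<open>prime p\<close> prime_gt_0_nat in auto)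
    then show "1 * (\<Prod>i\<in>UNIV. mean (\<lambda>z. u i (gcd z (p ^ e))) (p ^ e))
        \<le> mean (\<lambda>z. \<Prod>i\<in>UNIV. u i (gcd (z + 0) (p ^ e))) (p ^ e)"
      by (simp add: UNIV_bool mult.commute)
  qed (use assms in \<open>auto simp: blind_outside_def\<close>)
  then show ?thesis by (simp add: UNIV_bool mult.commute)
qed

text \<open>
  This replaces the estimate \<open>(\<Prod>i. x\<^sub>i) \<le> exp (- \<sigma>)\<close>, where \<open>\<sigma>\<close> is the sum of the \<open>1 - x\<^sub>i\<close>; the weaker
  upper bound \<open>1 / (1 + \<sigma>)\<close> suffices and has an elementary proof.
\<close>
lemma prod_times_one_plus_defect_le_1:
  fixes x :: "'i \<Rightarrow> real"
  assumes "finite I" "\<And>i. i \<in> I \<Longrightarrow> 0 \<le> x i \<and> x i \<le> 1"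
  shows "(\<Prod>i\<in>I. x i) * (1 + (\<Sum>i\<in>I. 1 - x i)) \<le> 1"
  using assms
proof (induction I)
  case (insert i I)
  define P where "P = (\<Prod>i\<in>I. x i)"
  define S where "S = (\<Sum>i\<in>I. 1 - x i)"
  have P: "0 \<le> P" unfolding P_def using insert by (intro prod_nonneg) auto
  have S: "0 \<le> S" unfolding S_def using insert by (intro sum_nonneg) auto
  have "x i * (1 + (1 - x i) + S) \<le> 1 + S"
  proof -
    have "0 \<le> (1 - x i) * ((1 - x i) + S)" using insert S by (intro mult_nonneg_nonneg) auto
    then show ?thesis by (simp add: algebra_simps)
  qed
  then have "P * (x i * (1 + (1 - x i) + S)) \<le> P * (1 + S)" using P by (rule mult_left_mono)
  also have "\<dots> \<le> 1" unfolding P_def S_def using insert by auto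
  finally show ?case using insert.hyps by (simp add: P_def S_def algebra_simps)
qed simp

lemma mean_prod_disjoint_defects:
  assumes "finite I" "Q > 0"
    and disj: "\<And>z i j. \<lbrakk>z < Q; i \<in> I; j \<in> I; \<phi> i z \<noteq> 1; \<phi> j z \<noteq> 1\<rbrakk> \<Longrightarrow> i = j"
  shows "mean (\<lambda>z. \<Prod>i\<in>I. \<phi> i z) Q = 1 - (\<Sum>i\<in>I. 1 - mean (\<phi> i) Q)"
proof -
  have "(\<Prod>i\<in>I. \<phi> i z) = 1 - (\<Sum>i\<in>I. 1 - \<phi> i z)" if "z < Q" for z
  proof (cases "\<exists>j\<in>I. \<phi> j z \<noteq> 1")
    case True
    then obtain j where j: "j \<in> I" "\<phi> j z \<noteq> 1" by blast
    have "\<phi> i z = 1" if "i \<in> I - {j}" for i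
      using disj [OF \<open>z < Q\<close> _ j(1) _ j(2)] that by blast
    then show ?thesis
      using \<open>finite I\<close> j(1) by (simp add: prod.remove [of I j] sum.remove [of I j])
  qed simp
  then have "mean (\<lambda>z. \<Prod>i\<in>I. \<phi> i z) Q = mean (\<lambda>z. 1 - (\<Sum>i\<in>I. 1 - \<phi> i z)) Q"
    by (intro mean_cong)
  also have "\<dots> = 1 - (\<Sum>i\<in>I. 1 - mean (\<phi> i) Q)"
    using \<open>Q > 0\<close> by (simp only: mean_diff mean_sum mean_const)
  finally show ?thesis .
qed

lemma blind_outside_prime_power:
  assumes "blind_outside R f" "prime p" "p \<notin> R"
  shows "f (p ^ k) = f 1"
  using assms by (induction k) (auto simp: blind_outside_def)

lemma mean_of_bool_dvd:
  assumes "p > 0"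
  shows "mean (\<lambda>z. of_bool (p dvd z)) p = 1 / real p"
proof -
  have "(\<Sum>z<p. of_bool (p dvd z) :: real) = (\<Sum>z\<in>{0::nat}. 1)"
    using assms by (intro sum.mono_neutral_cong_right) (auto simp: of_bool_def dest: dvd_imp_le)
  then show ?thesis by (simp add: mean_def)
qed

text \<open>
  After scaling each \<open>u\<^sub>i\<close> to have maximum \<open>1\<close>, its defect \<open>1 - u\<^sub>i\<close> lives on the residues \<open>z\<close> with
  \<open>z + s\<^sub>i\<close> divisible by \<open>p\<close>.  For distinct shifts these sets are disjoint, so the mean of the product is
  \<open>1 - \<sigma>\<close> with \<open>\<sigma>\<close> the sum of the mean defects, while the product of the means is at most \<open>1 / (1 + \<sigma>)\<close>.
  Since \<open>\<sigma>\<close> is at most \<open>card I / p\<close>, the loss is \<open>(card I / p)\<^sup>2\<close>.  If at most one \<open>u\<^sub>i\<close> depends on \<open>p\<close>, nothing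
  is lost; for this reason small primes, where the bound would be useless, can be allowed.
\<close>
lemma one_prime_shifted:
  fixes u :: "'i \<Rightarrow> nat \<Rightarrow> real"
  assumes "finite I" "prime p" "e > 0"
    and u: "\<And>i. i \<in> I \<Longrightarrow> div_antitone (u i)" "\<And>i. i \<in> I \<Longrightarrow> blind_outside (R i) (u i)"
    and sep: "\<And>i j. \<lbrakk>i \<in> I; j \<in> I; i \<noteq> j; p \<in> R i; p \<in> R j\<rbrakk> \<Longrightarrow>
                \<not> [s i = s j] (mod p) \<and> c \<le> 1 - (real (card I) / real p)\<^sup>2 \<and> card I \<le> p"
    and "c \<le> 1"
  shows "c * (\<Prod>i\<in>I. mean (\<lambda>z. u i (gcd z (p ^ e))) (p ^ e))
           \<le> mean (\<lambda>z. \<Prod>i\<in>I. u i (gcd (z + s i) (p ^ e))) (p ^ e)"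
proof (cases "\<exists>i\<in>I. u i 1 = 0")
  case True
  then obtain i where i: "i \<in> I" "u i 1 = 0" by blast
  then have "u i t = 0" for t
    using u(1) [OF i(1)] by (metis div_antitone_def one_dvd order_antisym)
  then have "(\<Prod>i\<in>I. mean (\<lambda>z. u i (gcd z (p ^ e))) (p ^ e)) = 0"
    using i \<open>finite I\<close> by (intro prod_zero bexI [of _ i]) (auto simp: mean_def)
  moreover have "0 \<le> mean (\<lambda>z. \<Prod>i\<in>I. u i (gcd (z + s i) (p ^ e))) (p ^ e)"
    using u(1) by (intro mean_nonneg prod_nonneg) (auto simp: div_antitone_def)
  ultimately show ?thesis by simp
next
  case False
  define q where "q = p ^ e"
  have "p > 0" "q > 0" using \<open>prime p\<close> prime_gt_0_nat by (auto simp: q_def)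
  have upos: "u i 1 > 0" if "i \<in> I" for i
    using False that u(1) [OF that] by (auto simp: div_antitone_def order_less_le)
  define \<phi> where "\<phi> = (\<lambda>i z. u i (gcd (z + s i) q) / u i 1)"
  have \<phi>01: "0 \<le> \<phi> i z" "\<phi> i z \<le> 1" if "i \<in> I" for i z
    using u(1) [OF that] upos [OF that] by (auto simp: \<phi>_def div_antitone_def)
  have active: "p \<in> R i \<and> p dvd z + s i" if "i \<in> I" "\<phi> i z \<noteq> 1" for i z
  proof -
    obtain k where k: "gcd (z + s i) q = p ^ k"
      unfolding q_def using divides_primepow_nat [OF \<open>prime p\<close>] gcd_dvd2 by meson
    then have ne: "u i (p ^ k) \<noteq> u i 1" using that upos [of i] by (auto simp: \<phi>_def)
    then have "p \<in> R i" using blind_outside_prime_power u(2) that \<open>prime p\<close> by metis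
    moreover have "k \<noteq> 0" using ne by (metis power_0)
    then have "p dvd z + s i" using k by (metis dvd_power dvd_trans gcd_dvd1 not_gr_zero)
    ultimately show ?thesis ..
  qed
  have disj: "i = j" if "z < q" "i \<in> I" "j \<in> I" "\<phi> i z \<noteq> 1" "\<phi> j z \<noteq> 1" for z i j
  proof (rule ccontr)
    assume "i \<noteq> j"
    have "p \<in> R i" "p dvd z + s i" "p \<in> R j" "p dvd z + s j"
      using active that by auto
    then have "[z + s i = z + s j] (mod p)" by (simp add: cong_def mod_eq_0_iff_dvd)
    then have "[s i = s j] (mod p)" by (simp add: cong_add_lcancel_nat)
    then show False using sep that \<open>i \<noteq> j\<close> \<open>p \<in> R i\<close> \<open>p \<in> R j\<close> by blast
  qed
  have m01: "0 \<le> mean (\<phi> i) q" "mean (\<phi> i) q \<le> 1" if "i \<in> I" for i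
    using \<phi>01 [OF that] \<open>q > 0\<close> mean_mono [of q "\<phi> i" "\<lambda>_. 1"]
    by (auto intro: mean_nonneg simp: mean_const)
  define \<sigma> where "\<sigma> = (\<Sum>i\<in>I. 1 - mean (\<phi> i) q)"
  define P where "P = (\<Prod>i\<in>I. mean (\<phi> i) q)"
  have P0: "0 \<le> P" unfolding P_def using m01 by (intro prod_nonneg) auto
  have key: "c * P \<le> 1 - \<sigma>"
  proof (cases "\<exists>i\<in>I. \<exists>j\<in>I. i \<noteq> j \<and> p \<in> R i \<and> p \<in> R j")
    case True
    then have c: "c \<le> 1 - (real (card I) / real p)\<^sup>2" "card I \<le> p" using sep by auto
    have "1 - mean (\<phi> i) q \<le> 1 / real p" if "i \<in> I" for i
    proof -
      have "1 - mean (\<phi> i) q = mean (\<lambda>z. 1 - \<phi> i z) q"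
        using \<open>q > 0\<close> by (simp add: mean_diff mean_const)
      also have "\<dots> \<le> mean (\<lambda>z. of_bool (p dvd z + s i)) q"
      proof (rule mean_mono)
        fix z
        show "1 - \<phi> i z \<le> of_bool (p dvd z + s i)"
          using active [OF that, of z] \<phi>01 [OF that, of z] by (cases "\<phi> i z = 1") auto
      qed
      also have "\<dots> = mean (\<lambda>z. of_bool (p dvd z)) q"
        by (rule mean_shift) (use \<open>e > 0\<close> in \<open>simp add: q_def dvd_mod_iff\<close>)
      also have "\<dots> = mean (\<lambda>z. of_bool (p dvd z)) p"
        by (rule mean_period) (use \<open>e > 0\<close> \<open>q > 0\<close> in \<open>auto simp: q_def dvd_mod_iff\<close>)
      finally show ?thesis using mean_of_bool_dvd [OF \<open>p > 0\<close>] by simp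
    qed
    then have "\<sigma> \<le> (\<Sum>i\<in>I. 1 / real p)" unfolding \<sigma>_def by (intro sum_mono) auto
    then have \<sigma>1: "\<sigma> \<le> real (card I) / real p" by simp
    have \<sigma>0: "0 \<le> \<sigma>" unfolding \<sigma>_def using m01 by (intro sum_nonneg) auto
    have \<sigma>le: "\<sigma> \<le> 1"
      using \<sigma>1 c(2) \<open>p > 0\<close> by (smt (verit) divide_le_eq_1_pos of_nat_0_less_iff of_nat_le_iff)
    have "\<sigma>\<^sup>2 \<le> (real (card I) / real p)\<^sup>2" using \<sigma>1 \<sigma>0 by (rule power_mono)
    then have "c \<le> 1 - \<sigma>\<^sup>2" using c(1) by linarith
    then have "c * P \<le> (1 - \<sigma>\<^sup>2) * P" using P0 by (rule mult_right_mono)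
    also have "\<dots> = (1 - \<sigma>) * (P * (1 + \<sigma>))" by (simp add: power2_eq_square algebra_simps)
    also have "\<dots> \<le> (1 - \<sigma>) * 1"
      unfolding P_def \<sigma>_def using prod_times_one_plus_defect_le_1 [of I "\<lambda>i. mean (\<phi> i) q"]
        \<open>finite I\<close> m01 \<sigma>le by (intro mult_left_mono) (auto simp: \<sigma>_def)
    finally show ?thesis by simp
  next
    case single: False
    have "P = 1 - \<sigma>"
    proof (cases "\<exists>i\<in>I. p \<in> R i")
      case True
      then obtain i where i: "i \<in> I" "\<And>j. j \<in> I - {i} \<Longrightarrow> p \<notin> R j" using single by blast
      then have "\<phi> j = (\<lambda>_. 1)" if "j \<in> I - {i}" for j using active [of j] that by blast
      then have "mean (\<phi> j) q = 1" if "j \<in> I - {i}" for j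
        using that \<open>q > 0\<close> by (simp add: mean_const)
      then show ?thesis
        unfolding P_def \<sigma>_def using \<open>finite I\<close> i
        by (simp add: prod.remove [of I i] sum.remove [of I i])
    next
      case False
      then have "\<phi> j = (\<lambda>_. 1)" if "j \<in> I" for j using active [of j] that by blast
      then show ?thesis using \<open>q > 0\<close> by (simp add: P_def \<sigma>_def mean_const)
    qed
    then show ?thesis using \<open>c \<le> 1\<close> P0 mult_right_mono [of c 1 P] by simp
  qed
  have meanu: "mean (\<lambda>z. u i (gcd z q)) q = u i 1 * mean (\<phi> i) q" if "i \<in> I" for i
  proof -
    have "mean (\<lambda>z. u i (gcd z q)) q = mean (\<lambda>z. u i (gcd (z + s i) q)) q"
      by (rule mean_shift [symmetric]) (rule gcd_shift_periodic)
    also have "\<dots> = mean (\<lambda>z. u i 1 * \<phi> i z) q"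
      using upos [OF that] by (simp add: \<phi>_def)
    finally show ?thesis by (simp add: mean_cmult)
  qed
  define U where "U = (\<Prod>i\<in>I. u i 1)"
  have U0: "0 \<le> U" unfolding U_def using upos by (intro prod_nonneg) (auto intro: less_imp_le)
  have "c * (\<Prod>i\<in>I. mean (\<lambda>z. u i (gcd z q)) q) = U * (c * P)"
    by (simp add: meanu prod.distrib U_def P_def)
  also have "\<dots> \<le> U * (1 - \<sigma>)" using key U0 by (rule mult_left_mono)
  also have "\<dots> = U * mean (\<lambda>z. \<Prod>i\<in>I. \<phi> i z) q"
    unfolding \<sigma>_def using mean_prod_disjoint_defects [OF \<open>finite I\<close> \<open>q > 0\<close>, of \<phi>] disj by simp
  also have "\<dots> = mean (\<lambda>z. \<Prod>i\<in>I. u i 1 * \<phi> i z) q"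
    by (simp add: U_def prod.distrib mean_cmult)
  also have "\<dots> = mean (\<lambda>z. \<Prod>i\<in>I. u i (gcd (z + s i) q)) q"
  proof (intro mean_cong prod.cong refl)
    fix z i assume "i \<in> I"
    then show "u i 1 * \<phi> i z = u i (gcd (z + s i) q)" using upos [of i] by (simp add: \<phi>_def)
  qed
  finally show ?thesis by (simp add: q_def)
qed

lemma sum_inverse_squares_le:
  assumes "finite A" "\<And>k. k \<in> A \<Longrightarrow> M < k" "M > 0"
  shows "(\<Sum>k\<in>A. 1 / (real k)\<^sup>2) \<le> 1 / real M"
proof -
  have tele: "(\<Sum>k\<in>{M<..M + n}. 1 / (real k)\<^sup>2) \<le> 1 / real M - 1 / real (M + n)" for n
  proof (induction n)
    case (Suc n)
    have "(\<Sum>k\<in>{M<..M + Suc n}. 1 / (real k)\<^sup>2)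
        = (\<Sum>k\<in>{M<..M + n}. 1 / (real k)\<^sup>2) + 1 / (real (M + Suc n))\<^sup>2"
      by (simp add: atLeastSucAtMost_greaterThanAtMost [symmetric])
    also have "\<dots> \<le> 1 / real M - 1 / real (M + n) + 1 / (real (M + Suc n))\<^sup>2"
      using Suc by simp
    also have "\<dots> \<le> 1 / real M - 1 / real (M + Suc n)"
    proof -
      have "1 / (x + 1)\<^sup>2 \<le> 1 / x - 1 / (x + 1)" if "x > 0" for x :: real
        using that by (simp add: divide_simps power2_eq_square)
      from this [of "real (M + n)"] show ?thesis using \<open>M > 0\<close> by (simp add: algebra_simps)
    qed
    finally show ?case .
  qed simp
  have "A \<subseteq> {M<..M + Max (insert 0 A)}"
    using assms by (auto simp: le_add2 intro!: trans_le_add2)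
  then have "(\<Sum>k\<in>A. 1 / (real k)\<^sup>2) \<le> (\<Sum>k\<in>{M<..M + Max (insert 0 A)}. 1 / (real k)\<^sup>2)"
    by (intro sum_mono2) auto
  also have "\<dots> \<le> 1 / real M" using tele [of "Max (insert 0 A)"] by (smt (verit) divide_nonneg_nonneg of_nat_0_le_iff)
  finally show ?thesis .
qed

lemma prod_ge_one_minus_sum:
  fixes a :: "'i \<Rightarrow> real"
  assumes "finite A" "\<And>i. i \<in> A \<Longrightarrow> 0 \<le> a i \<and> a i \<le> 1"
  shows "1 - (\<Sum>i\<in>A. a i) \<le> (\<Prod>i\<in>A. 1 - a i)"
  using assms
proof (induction A)
  case (insert i A)
  have p: "(\<Prod>i\<in>A. 1 - a i) \<le> 1" using insert by (intro prod_le_1) auto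
  have "1 - (\<Sum>i\<in>A. a i) - a i \<le> (\<Prod>i\<in>A. 1 - a i) - a i * (\<Prod>i\<in>A. 1 - a i)"
    using insert p mult_left_mono [OF p, of "a i"] by fastforce
  then show ?case using insert.hyps by (simp add: algebra_simps)
qed simp

text \<open>
  The threshold \<open>2 * (card I)\<^sup>2\<close> makes the losses \<open>(card I / p)\<^sup>2\<close> at the primes shared by two functions
  sum to at most \<open>1 / 2\<close>.
\<close>
theorem shifted_behrend_inequality:
  fixes f :: "'i \<Rightarrow> nat \<Rightarrow> real"
  assumes "finite I" "Q > 0"
    and f: "\<And>i. i \<in> I \<Longrightarrow> div_antitone (f i)" "\<And>i. i \<in> I \<Longrightarrow> blind_outside (R i) (f i)"
    and sep: "\<And>i j p. \<lbrakk>i \<in> I; j \<in> I; i \<noteq> j; prime p; p \<in> R i; p \<in> R j\<rbrakk> \<Longrightarrow>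
                \<not> [s i = s j] (mod p) \<and> 2 * (card I)\<^sup>2 < p"
  shows "(1 / 2) * (\<Prod>i\<in>I. mean (\<lambda>x. f i (gcd x Q)) Q)
           \<le> mean (\<lambda>x. \<Prod>i\<in>I. f i (gcd (x + s i) Q)) Q"
proof -
  define m where "m = card I"
  \<comment> \<open>The loss at \<open>p\<close>.  At primes up to the threshold at most one function is sensitive, and there is no loss.\<close>
  define a where "a = (\<lambda>p. if 2 * m\<^sup>2 < p then (real m / real p)\<^sup>2 else 0)"
  have mp: "m \<le> p" if "2 * m\<^sup>2 < p" for p
  proof -
    have "m \<le> m\<^sup>2" by (simp add: power2_eq_square)
    then show ?thesis using that by simp
  qed
  have a01: "0 \<le> a p" "a p \<le> 1" for p
    using mp [of p] by (auto simp: a_def power_le_one_iff divide_le_eq_1)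
  have asum: "(\<Sum>p\<in>prime_factors Q. a p) \<le> 1 / 2"
  proof (cases "m = 0")
    case False
    have "(\<Sum>p\<in>prime_factors Q. a p) = (\<Sum>p\<in>{p \<in> prime_factors Q. 2 * m\<^sup>2 < p}. (real m)\<^sup>2 * (1 / (real p)\<^sup>2))"
      by (auto simp: a_def power_divide sum.If_cases Int_def intro!: sum.cong)
    also have "\<dots> = (real m)\<^sup>2 * (\<Sum>p\<in>{p \<in> prime_factors Q. 2 * m\<^sup>2 < p}. 1 / (real p)\<^sup>2)"
      by (simp add: sum_distrib_left)
    also have "\<dots> \<le> (real m)\<^sup>2 * (1 / real (2 * m\<^sup>2))"
      using False by (intro mult_left_mono sum_inverse_squares_le) auto
    also have "\<dots> = 1 / 2" using False by simp
    finally show ?thesis .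
  next
    case True
    then have "a p = 0" for p by (simp add: a_def)
    then show ?thesis by simp
  qed
  have nonneg: "0 \<le> (\<Prod>i\<in>I. mean (\<lambda>x. f i (gcd x Q)) Q)"
    using f by (intro prod_nonneg mean_nonneg) (auto simp: div_antitone_def)
  have "1 / 2 \<le> (\<Prod>p\<in>prime_factors Q. 1 - a p)"
    using prod_ge_one_minus_sum [of "prime_factors Q" a] a01 asum by auto
  then have "(1 / 2) * (\<Prod>i\<in>I. mean (\<lambda>x. f i (gcd x Q)) Q)
      \<le> (\<Prod>p\<in>prime_factors Q. 1 - a p) * (\<Prod>i\<in>I. mean (\<lambda>x. f i (gcd x Q)) Q)"
    using nonneg by (rule mult_right_mono)
  also have "\<dots> \<le> mean (\<lambda>x. \<Prod>i\<in>I. f i (gcd (x + s i) Q)) Q"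
  proof (rule mean_prod_ge_prod_mean [OF \<open>finite I\<close> \<open>Q > 0\<close> f])
    fix p e :: nat and u :: "'i \<Rightarrow> nat \<Rightarrow> real"
    assume p: "p \<in> prime_factors Q" and "e > 0"
      and u: "\<And>i. i \<in> I \<Longrightarrow> div_antitone (u i)" "\<And>i. i \<in> I \<Longrightarrow> blind_outside (R i) (u i)"
    then have "prime p" by auto
    show "(1 - a p) * (\<Prod>i\<in>I. mean (\<lambda>z. u i (gcd z (p ^ e))) (p ^ e))
           \<le> mean (\<lambda>z. \<Prod>i\<in>I. u i (gcd (z + s i) (p ^ e))) (p ^ e)"
    proof (rule one_prime_shifted [OF \<open>finite I\<close> \<open>prime p\<close> \<open>e > 0\<close> u])
      fix i j assume ij: "i \<in> I" "j \<in> I" "i \<noteq> j" "p \<in> R i" "p \<in> R j"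
      then show "\<not> [s i = s j] (mod p) \<and> 1 - a p \<le> 1 - (real (card I) / real p)\<^sup>2 \<and> card I \<le> p"
        using sep [OF ij(1-3) \<open>prime p\<close> ij(4,5)] mp by (auto simp: a_def m_def)
    qed (use a01 in auto)
  qed (use a01 in auto)
  finally show ?thesis .
qed

section \<open>Densities of sifted sets and the theorem of Davenport and Erdos\<close>

definition sifted :: "nat set \<Rightarrow> nat \<Rightarrow> real" where
  "sifted A x = of_bool (\<forall>a\<in>A. \<not> a dvd x)"

definition sift_density :: "nat set \<Rightarrow> real" where
  "sift_density A = mean (sifted A) (Lcm A)"

lemma sifted_01: "0 \<le> sifted A x" "sifted A x \<le> 1"
  by (auto simp: sifted_def)

lemma sifted_antimono: "A \<subseteq> C \<Longrightarrow> sifted C x \<le> sifted A x"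
  by (auto simp: sifted_def)

lemma sifted_Un: "sifted (A \<union> C) x = sifted A x * sifted C x"
  by (auto simp: sifted_def)

lemma div_antitone_sifted: "div_antitone (sifted A)"
  by (auto simp: div_antitone_def sifted_def intro: dvd_trans)

lemma blind_outside_sifted: "blind_outside {p. \<exists>a\<in>A. p dvd a} (sifted A)"
proof -
  have "a dvd p * d \<longleftrightarrow> a dvd d" if "prime p" "\<not> p dvd a" for p a d :: nat
    using prime_imp_coprime [OF that] by (metis coprime_commute coprime_dvd_mult_right_iff)
  then show ?thesis by (auto simp: blind_outside_def sifted_def)
qed

lemma sifted_gcd:
  assumes "\<And>a. a \<in> A \<Longrightarrow> a dvd Q"
  shows "sifted A (gcd x Q) = sifted A x"
  using assms by (auto simp: sifted_def)

lemma sifted_periodic: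
  assumes "\<And>a. a \<in> A \<Longrightarrow> a dvd Q"
  shows "sifted A (x mod Q) = sifted A x"
  using assms by (auto simp: sifted_def dvd_mod_iff)

lemma Lcm_pos_nat: "finite A \<Longrightarrow> 0 \<notin> A \<Longrightarrow> Lcm A > (0::nat)"
  by (metis Lcm_0_iff gr0I)

lemma sift_density_eq:
  assumes "\<And>a. a \<in> A \<Longrightarrow> a dvd Q" "Q > 0"
  shows "sift_density A = mean (sifted A) Q"
  unfolding sift_density_def
  by (rule mean_period [symmetric]) (use assms in \<open>auto intro: Lcm_least sifted_periodic\<close>)

lemma sift_density_antimono:
  assumes "finite C" "0 \<notin> C" "A \<subseteq> C"
  shows "sift_density C \<le> sift_density A"
proof -
  have "Lcm C > 0" using Lcm_pos_nat assms by blast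
  moreover have "a dvd Lcm C" if "a \<in> A" for a using that assms by auto
  ultimately have "sift_density A = mean (sifted A) (Lcm C)" by (intro sift_density_eq) auto
  then show ?thesis
    using assms by (simp add: sift_density_def mean_mono sifted_antimono)
qed

lemma sift_density_nonneg: "0 \<le> sift_density A"
  unfolding sift_density_def by (intro mean_nonneg sifted_01)

lemma sift_density_Un_ge:
  assumes "finite A" "finite C" "0 \<notin> A" "0 \<notin> C"
  shows "sift_density A * sift_density C \<le> sift_density (A \<union> C)"
proof -
  define Q where "Q = Lcm (A \<union> C)"
  have Q: "Q > 0" unfolding Q_def using assms by (intro Lcm_pos_nat) auto
  have dvd: "a dvd Q" if "a \<in> A \<union> C" for a using that by (simp add: Q_def)
  have dens: "sift_density X = mean (\<lambda>x. sifted X (gcd x Q)) Q" if "X \<subseteq> A \<union> C" for X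
    using sift_density_eq [of X Q] sifted_gcd [of X Q] that dvd Q by (metis (no_types, lifting) mean_cong subsetD)
  have "sift_density A * sift_density C
      \<le> mean (\<lambda>x. sifted A (gcd x Q) * sifted C (gcd x Q)) Q"
    using behrend_inequality [OF div_antitone_sifted div_antitone_sifted Q, of A C] by (simp add: dens)
  then show ?thesis by (simp add: dens sifted_Un)
qed

lemma sift_density_UN_ge:
  assumes "finite I" "\<And>i. i \<in> I \<Longrightarrow> finite (A i)" "\<And>i. i \<in> I \<Longrightarrow> 0 \<notin> A i"
  shows "(\<Prod>i\<in>I. sift_density (A i)) \<le> sift_density (\<Union>i\<in>I. A i)"
  using assms
proof (induction I)
  case empty
  then show ?case by (simp add: sift_density_def mean_def sifted_def)
next
  case (insert i I)
  have "(\<Prod>i\<in>insert i I. sift_density (A i)) \<le> sift_density (A i) * sift_density (\<Union>i\<in>I. A i)"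
    using insert by (simp add: mult_left_mono sift_density_nonneg)
  also have "\<dots> \<le> sift_density (A i \<union> (\<Union>i\<in>I. A i))"
    using insert by (intro sift_density_Un_ge) auto
  finally show ?case by simp
qed

text \<open>
  Each \<open>d \<le> N\<close> is the gcd with \<open>Q\<close> of exactly \<open>totient (Q div d)\<close> residues.  As \<open>Q\<close> contains every prime factor
  of \<open>d\<close> to a higher power than \<open>d\<close> does, \<open>Q div d\<close> has the same prime factors as \<open>Q\<close>, and the count is
  proportional to \<open>1 / d\<close>.  In this way harmonic sums up to \<open>N\<close> become means over residues.
\<close>
lemma mean_gcd_harmonic:
  assumes Q: "Q = (fact N)\<^sup>2 * L" "L > 0" and h: "\<And>d. h d \<noteq> 0 \<Longrightarrow> 1 \<le> d \<and> d \<le> N"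
  shows "mean (\<lambda>x. h (gcd x Q)) Q = real (totient Q) / real Q * (\<Sum>d=1..N. h d / real d)"
proof -
  have "Q > 0" using Q by simp
  have dQ: "d dvd Q" and tot: "real (totient (Q div d)) = real (totient Q) / real d"
    if d: "d \<in> {1..N}" for d
  proof -
    have "d dvd fact N" using d by (simp add: dvd_fact)
    then obtain k where k: "fact N = d * k" by (auto simp: dvd_def)
    have Qd: "Q = d * (k * fact N * L)" using Q k by (simp add: power2_eq_square mult_ac)
    then show "d dvd Q" by simp
    have div: "Q div d = k * fact N * L" using Qd d by simp
    have "prime_factors (Q div d) = prime_factors Q"
    proof -
      have "p dvd Q div d" if "prime p" "p dvd Q" for p
      proof -
        have "p dvd fact N * L"
          using that unfolding Q(1) by (auto simp: prime_dvd_mult_iff prime_dvd_power_iff)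
        then show ?thesis unfolding div by (simp add: mult.assoc)
      qed
      moreover have quot: "Q div d dvd Q" using \<open>d dvd Q\<close> by (metis dvd_div_mult_self dvd_triv_left)
      moreover have "Q div d > 0" using \<open>Q > 0\<close> quot by (rule dvd_pos_nat)
      ultimately show ?thesis using \<open>Q > 0\<close> by (auto simp: prime_factors_dvd intro: dvd_trans)
    qed
    then show "real (totient (Q div d)) = real (totient Q) / real d"
      using \<open>d dvd Q\<close> by (simp add: totient_formula2 real_of_nat_div)
  qed
  have "(\<Sum>x<Q. h (gcd x Q)) + h (gcd Q Q) = (\<Sum>x<Suc Q. h (gcd x Q))" by simp
  also have "\<dots> = h (gcd 0 Q) + (\<Sum>x<Q. h (gcd (Suc x) Q))" by (rule sum.lessThan_Suc_shift)
  also have "(\<Sum>x<Q. h (gcd (Suc x) Q)) = (\<Sum>x\<in>{0<..Q}. h (gcd x Q))"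
    by (rule sum.reindex_bij_witness [of _ "\<lambda>x. x - 1" Suc]) auto
  finally have "(\<Sum>x<Q. h (gcd x Q)) = (\<Sum>x\<in>{0<..Q}. h (gcd x Q))" by simp
  also have "\<dots> = (\<Sum>x\<in>{x\<in>{0<..Q}. gcd x Q \<in> {1..N}}. h (gcd x Q))"
    using h by (intro sum.mono_neutral_right) fastforce+
  also have "\<dots> = (\<Sum>d\<in>{1..N}. \<Sum>x\<in>{x\<in>{x\<in>{0<..Q}. gcd x Q \<in> {1..N}}. gcd x Q = d}. h (gcd x Q))"
    by (rule sum.group [symmetric]) auto
  also have "\<dots> = (\<Sum>d\<in>{1..N}. real (totient Q) * (h d / real d))"
  proof (rule sum.cong [OF refl])
    fix d assume d: "d \<in> {1..N}"
    have "{x\<in>{x\<in>{0<..Q}. gcd x Q \<in> {1..N}}. gcd x Q = d} = {x\<in>{0<..Q}. gcd x Q = d}"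
      using d by auto
    then have "(\<Sum>x\<in>{x\<in>{x\<in>{0<..Q}. gcd x Q \<in> {1..N}}. gcd x Q = d}. h (gcd x Q))
        = (\<Sum>x\<in>{x\<in>{0<..Q}. gcd x Q = d}. h d)"
      by (intro sum.cong) auto
    also have "\<dots> = real (totient Q) * (h d / real d)"
      using card_gcd_eq_totient [OF \<open>Q > 0\<close> dQ [OF d]] tot [OF d] by simp
    finally show "(\<Sum>x\<in>{x\<in>{x\<in>{0<..Q}. gcd x Q \<in> {1..N}}. gcd x Q = d}. h (gcd x Q))
        = real (totient Q) * (h d / real d)" .
  qed
  also have "\<dots> = real (totient Q) * (\<Sum>d=1..N. h d / real d)"
    by (simp only: sum_distrib_left)
  finally show ?thesis by (simp add: mean_def)
qed

text \<open>
  For harmonic weights a sifted set is never thinner on an initial segment than in density, with no error term.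
  This is Behrend's inequality for the sifted set and the set \<open>{1..N}\<close>, both closed under divisors.
\<close>
lemma sift_density_harmonic_le:
  assumes "finite A" "0 \<notin> A"
  shows "sift_density A * (\<Sum>x=1..N. 1 / real x) \<le> (\<Sum>x=1..N. sifted A x / real x)"
proof -
  define Q where "Q = (fact N)\<^sup>2 * Lcm A"
  define g where "g = (\<lambda>d. of_bool (1 \<le> d \<and> d \<le> N) :: real)"
  have L: "Lcm A > 0" using assms by (rule Lcm_pos_nat)
  have "Q > 0" using L by (simp add: Q_def)
  have dvd: "a dvd Q" if "a \<in> A" for a using that by (simp add: Q_def)
  have "div_antitone g"
    unfolding div_antitone_def g_def using dvd_imp_le by (auto intro: Suc_leI gr0I order_trans)
  define c where "c = real (totient Q) / real Q"
  have "c > 0" using \<open>Q > 0\<close> by (simp add: c_def)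
  have A: "sift_density A = mean (\<lambda>x. sifted A (gcd x Q)) Q"
    using sift_density_eq [of A Q] sifted_gcd [of A Q] dvd \<open>Q > 0\<close> by simp
  have G: "mean (\<lambda>x. g (gcd x Q)) Q = c * (\<Sum>x=1..N. 1 / real x)"
    unfolding c_def by (subst mean_gcd_harmonic [OF Q_def L]) (auto simp: g_def)
  have AG: "mean (\<lambda>x. sifted A (gcd x Q) * g (gcd x Q)) Q = c * (\<Sum>x=1..N. sifted A x / real x)"
    unfolding c_def
    by (subst mean_gcd_harmonic [OF Q_def L, where h = "\<lambda>d. sifted A d * g d"]) (auto simp: g_def)
  have "sift_density A * (c * (\<Sum>x=1..N. 1 / real x)) \<le> c * (\<Sum>x=1..N. sifted A x / real x)"
    using behrend_inequality [OF div_antitone_sifted \<open>div_antitone g\<close> \<open>Q > 0\<close>, of A]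
    unfolding G AG A [symmetric] .
  then show ?thesis using \<open>c > 0\<close> by (simp add: mult.left_commute)
qed

text \<open>Summation by parts.\<close>
lemma harmonic_sum_le_of_partial_sums_le:
  fixes a :: "nat \<Rightarrow> real"
  assumes s: "\<And>n. (\<Sum>x=1..n. a x) \<le> C" and "0 \<le> C"
  shows "(\<Sum>x=1..N. a x / real x) \<le> C"
proof -
  define S where "S n = (\<Sum>x=1..n. a x)" for n
  have step: "T + (S2 - S1) * v \<le> S2 * v + C * (1 - v)"
    if "T \<le> S1 * u + C * (1 - u)" "0 \<le> (C - S1) * (u - v)" for T S1 S2 u v :: real
    using that by (simp add: algebra_simps)
  have le: "(\<Sum>x=1..Suc n. a x / real x) \<le> S (Suc n) * (1 / real (Suc n)) + C * (1 - 1 / real (Suc n))" for n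
  proof (induction n)
    case 0
    then show ?case by (simp add: S_def)
  next
    case (Suc n)
    have "0 \<le> (C - S (Suc n)) * (1 / real (Suc n) - 1 / real (Suc (Suc n)))"
      using s [of "Suc n"] by (intro mult_nonneg_nonneg) (auto simp: S_def frac_le)
    from step [OF Suc.IH this, of "S (Suc (Suc n))"] show ?case
      by (simp add: S_def)
  qed
  have leC: "S (Suc n) * (1 / real (Suc n)) + C * (1 - 1 / real (Suc n)) \<le> C" for n
  proof -
    have "S (Suc n) / real (Suc n) \<le> C / real (Suc n)"
      unfolding S_def by (intro divide_right_mono s) simp
    then show ?thesis by (simp add: algebra_simps)
  qed
  show ?thesis
  proof (cases N)
    case 0
    then show ?thesis using \<open>0 \<le> C\<close> by simp
  next
    case (Suc n)
    then show ?thesis using order_trans [OF le leC] by blast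
  qed
qed

lemma sifted_sum_bounds:
  assumes "finite A" "0 \<notin> A"
  obtains C where "\<And>N. real N * sift_density A - C \<le> (\<Sum>x=1..N. sifted A x)"
    "\<And>N. (\<Sum>x=1..N. sifted A x) \<le> real N * sift_density A + C"
proof
  let ?Q = "Lcm A"
  have Q: "?Q > 0" using assms by (rule Lcm_pos_nat)
  have per: "sifted A (x mod ?Q) = sifted A x" for x by (rule sifted_periodic) simp
  fix N
  have "(\<Sum>x<N. sifted A x) + sifted A N = (\<Sum>x<Suc N. sifted A x)" by simp
  also have "\<dots> = sifted A 0 + (\<Sum>x<N. sifted A (Suc x))" by (rule sum.lessThan_Suc_shift)
  also have "(\<Sum>x<N. sifted A (Suc x)) = (\<Sum>x=1..N. sifted A x)"
    by (rule sum.reindex_bij_witness [of _ "\<lambda>x. x - 1" Suc]) auto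
  finally have eq: "(\<Sum>x<N. sifted A x) + sifted A N = sifted A 0 + (\<Sum>x=1..N. sifted A x)" .
  note b = sum_periodic_bounds [of "sifted A" ?Q N, OF per Q sifted_01, folded sift_density_def]
  show "real N * sift_density A - (real ?Q + 1) \<le> (\<Sum>x=1..N. sifted A x)"
    "(\<Sum>x=1..N. sifted A x) \<le> real N * sift_density A + (real ?Q + 1)"
    using eq b sifted_01 [of A 0] sifted_01 [of A N] by linarith+
qed

text \<open>
  Choose \<open>B\<^sub>0\<close> with density close to the infimum \<open>\<delta>\<close> over all finite subsets.  If the elements of \<open>B\<close>
  outside \<open>B\<^sub>0\<close> removed more than \<open>\<epsilon> N\<close> integers up to \<open>N\<close> for all large \<open>N\<close>, the integers surviving all of \<open>B\<close>
  would have counting function below \<open>(\<delta> - \<epsilon> / 2) N\<close>, and by partial summation a harmonic sum below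
  \<open>\<delta> - \<epsilon> / 2\<close> times the harmonic number, up to a constant.  But up to \<open>N\<close> only the finitely many \<open>b \<le> N\<close>
  matter, so that the harmonic sum is at least \<open>\<delta>\<close> times the harmonic number.
\<close>
theorem davenport_erdos:
  assumes "0 \<notin> B" "\<epsilon> > 0"
  obtains B0 where "finite B0" "B0 \<subseteq> B"
    "\<And>M. \<exists>N\<ge>M. (\<Sum>x=1..N. sifted B0 x - sifted B x) \<le> \<epsilon> * real N"
proof -
  define \<F> where "\<F> = {B0. finite B0 \<and> B0 \<subseteq> B}"
  define \<delta> where "\<delta> = Inf (sift_density ` \<F>)"
  have bdd: "bdd_below (sift_density ` \<F>)" by (rule bdd_belowI [of _ 0]) (auto simp: sift_density_nonneg)
  have ne: "sift_density ` \<F> \<noteq> {}" by (auto simp: \<F>_def)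
  have \<delta>le: "\<delta> \<le> sift_density B0" if "B0 \<in> \<F>" for B0
    unfolding \<delta>_def using bdd that by (simp add: cINF_lower)
  obtain B0 where B0: "finite B0" "B0 \<subseteq> B" "sift_density B0 < \<delta> + \<epsilon> / 2"
    using cInf_lessD [OF ne, of "\<delta> + \<epsilon> / 2"] \<open>\<epsilon> > 0\<close> unfolding \<delta>_def \<F>_def by auto
  have "\<exists>N\<ge>M. (\<Sum>x=1..N. sifted B0 x - sifted B x) \<le> \<epsilon> * real N" for M
  proof (rule ccontr)
    assume "\<not> ?thesis"
    then have big: "(\<Sum>x=1..N. sifted B0 x - sifted B x) > \<epsilon> * real N" if "N \<ge> M" for N
      using that by (meson not_le)
    obtain C0 where C0: "\<And>N. (\<Sum>x=1..N. sifted B0 x) \<le> real N * sift_density B0 + C0"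
      using sifted_sum_bounds [OF B0(1)] B0(2) assms(1) by (metis subsetD)
    define \<beta> where "\<beta> = \<delta> - \<epsilon> / 2"
    define C where "C = \<bar>C0\<bar> + real M * (1 + \<bar>\<beta>\<bar>)"
    have "C \<ge> 0" by (simp add: C_def)
    have part: "(\<Sum>x=1..n. sifted B x - \<beta>) \<le> C" for n
    proof (cases "n \<ge> M")
      case True
      have "real n * sift_density B0 \<le> real n * (\<delta> + \<epsilon> / 2)" using B0(3) by (intro mult_left_mono) auto
      then have "(\<Sum>x=1..n. sifted B x - \<beta>) \<le> C0"
        using big [OF True] C0 [of n] unfolding sum_subtractf by (simp add: \<beta>_def algebra_simps)
      also have "\<dots> \<le> C" by (simp add: C_def add_increasing2)
      finally show ?thesis .
    next
      case False
      have "(\<Sum>x=1..n. sifted B x - \<beta>) \<le> (\<Sum>x=1..n. 1 + \<bar>\<beta>\<bar>)"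
        using sifted_01 [of B] by (intro sum_mono) (smt (verit))
      also have "\<dots> = real n * (1 + \<bar>\<beta>\<bar>)" by simp
      also have "\<dots> \<le> real M * (1 + \<bar>\<beta>\<bar>)" using False by (intro mult_right_mono) auto
      finally show ?thesis by (simp add: C_def)
    qed
    have H: "(\<epsilon> / 2) * harm N \<le> C" for N
    proof -
      have hs: "(\<Sum>x=1..N. 1 / real x) = harm N" by (simp add: harm_def inverse_eq_divide)
      have fin: "B \<inter> {1..N} \<in> \<F>" by (auto simp: \<F>_def)
      have "\<delta> * harm N \<le> sift_density (B \<inter> {1..N}) * harm N"
        using \<delta>le [OF fin] by (intro mult_right_mono) (auto simp: harm_nonneg)
      also have "\<dots> \<le> (\<Sum>x=1..N. sifted (B \<inter> {1..N}) x / real x)"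
        unfolding hs [symmetric] by (rule sift_density_harmonic_le) auto
      also have "\<dots> = (\<Sum>x=1..N. sifted B x / real x)"
      proof (rule sum.cong [OF refl])
        fix x assume x: "x \<in> {1..N}"
        then have "b \<in> {1..N}" if "b dvd x" for b
          using that dvd_pos_nat [of x b] dvd_imp_le [of b x] by auto
        then have "(\<forall>a\<in>B \<inter> {1..N}. \<not> a dvd x) \<longleftrightarrow> (\<forall>a\<in>B. \<not> a dvd x)" by blast
        then show "sifted (B \<inter> {1..N}) x / real x = sifted B x / real x"
          unfolding sifted_def by simp
      qed
      also have "\<dots> = (\<Sum>x=1..N. (sifted B x - \<beta>) / real x) + \<beta> * harm N"
        unfolding hs [symmetric] by (simp add: diff_divide_distrib sum_subtractf sum_distrib_left)
      also have "(\<Sum>x=1..N. (sifted B x - \<beta>) / real x) \<le> C"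
        using part \<open>C \<ge> 0\<close> by (rule harmonic_sum_le_of_partial_sums_le)
      finally show ?thesis by (simp add: \<beta>_def algebra_simps)
    qed
    have "filterlim (\<lambda>N. harm N :: real) at_top sequentially" by (rule harm_at_top)
    then have "eventually (\<lambda>N. (harm N :: real) > C / (\<epsilon> / 2)) sequentially"
      by (simp add: filterlim_at_top_dense)
    then obtain N where "(harm N :: real) > C / (\<epsilon> / 2)" by (auto simp: eventually_sequentially)
    then have "(\<epsilon> / 2) * harm N > C" using \<open>\<epsilon> > 0\<close> by (simp add: field_simps)
    then show False using H [of N] by simp
  qed
  then show thesis using that B0 by blast
qed

section \<open>Tautness excludes dilated Behrend sets\<close>

lemma sift_density_singleton:
  assumes "a > 0" shows "sift_density {a} = 1 - 1 / real a"
proof -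
  have "sift_density {a} = mean (\<lambda>x. 1 - of_bool (a dvd x)) a"
    unfolding sift_density_def by (auto simp: sifted_def of_bool_def intro!: mean_cong)
  then show ?thesis using assms by (simp only: mean_diff mean_const mean_of_bool_dvd)
qed

lemma card_multiples:
  "real (card (multiples B \<inter> {1..int N})) = (\<Sum>x=1..N. 1 - sifted B x)"
proof -
  have "multiples B \<inter> {1..int N} = int ` {x\<in>{1..N}. \<exists>b\<in>B. b dvd x}"
  proof (rule subset_antisym; rule subsetI)
    fix y assume y: "y \<in> multiples B \<inter> {1..int N}"
    then obtain b where b: "b \<in> B" "int b dvd y" by (auto simp: multiples_def)
    have "int (nat y) = y" using y by simp
    moreover have "b dvd nat y" using b y by (metis \<open>int (nat y) = y\<close> int_dvd_int_iff)
    ultimately show "y \<in> int ` {x\<in>{1..N}. \<exists>b\<in>B. b dvd x}"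
      using b y by (intro image_eqI [of _ _ "nat y"]) auto
  next
    fix y assume "y \<in> int ` {x\<in>{1..N}. \<exists>b\<in>B. b dvd x}"
    then obtain x b where x: "y = int x" "x \<in> {1..N}" "b \<in> B" "b dvd x" by blast
    then obtain k where "x = b * k" by blast
    then have "y = int b * int k" using x(1) by simp
    then have "y \<in> range (\<lambda>k. int b * k)" by (rule range_eqI)
    then have "y \<in> multiples B" unfolding multiples_def using x(3) by (rule UN_I [rotated])
    moreover have "y \<in> {1..int N}" using x(1,2) by auto
    ultimately show "y \<in> multiples B \<inter> {1..int N}" by (rule IntI)
  qed
  then have "real (card (multiples B \<inter> {1..int N})) = real (card {x\<in>{1..N}. \<exists>b\<in>B. b dvd x})"
    by (simp add: card_image)
  also have "\<dots> = (\<Sum>x\<in>{x\<in>{1..N}. \<exists>b\<in>B. b dvd x}. 1)" by simp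
  also have "\<dots> = (\<Sum>x=1..N. 1 - sifted B x)"
    by (rule sum.mono_neutral_cong_left) (auto simp: sifted_def)
  finally show ?thesis .
qed

text \<open>
  Suppose that finite subsets of \<open>A\<close> have sifted sets of arbitrarily small density, and take \<open>a \<in> A\<close>.  Behrend's
  inequality with the singleton \<open>{a}\<close>, \<open>a \<ge> 2\<close>, shows that this remains so after removing \<open>a\<close>.  Hence almost
  all multiples of \<open>g\<close>, and in particular of \<open>b = g * a\<close>, are multiples of some other element of \<open>B\<close>, so
  that \<open>b\<close> does not contribute to the lower density.
\<close>
theorem taut_sift_density_bounded_below:
  assumes B: "B \<subseteq> {1..}" "taut B" and A: "(\<lambda>a. g * a) ` A \<subseteq> B" "1 \<notin> A"
  obtains \<delta> where "\<delta> > 0" "\<And>A0. finite A0 \<Longrightarrow> A0 \<subseteq> A \<Longrightarrow> \<delta> \<le> sift_density A0"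
proof (rule ccontr)
  assume no_bound: "\<not> thesis"
  note bound = that
  have small: "\<exists>A0. finite A0 \<and> A0 \<subseteq> A \<and> sift_density A0 < \<delta>" if "\<delta> > 0" for \<delta>
    using no_bound bound [OF that] by (meson not_le)
  have pos: "g * a > 0" if "a \<in> A" for a using A(1) B(1) that by fastforce
  have "A \<noteq> {}"
  proof
    assume "A = {}"
    then show False using small [of 1] by (auto simp: sift_density_def mean_def sifted_def)
  qed
  then obtain a where a: "a \<in> A" by blast
  define b where "b = g * a"
  have "g > 0" "a > 0" using pos [OF a] by auto
  have "a \<ge> 2" using a A(2) \<open>a > 0\<close> by (metis One_nat_def Suc_leI less_Suc_eq_le not_less_eq_eq numeral_2_eq_2 le_antisym)
  have "b \<in> B" using A(1) a by (auto simp: b_def)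
  then have "lower_density (multiples (B - {b})) < lower_density (multiples B)"
    using B(2) by (simp add: taut_def)
  then obtain c1 where c1: "lower_density (multiples (B - {b})) < ereal c1"
    "ereal c1 < lower_density (multiples B)" using ereal_dense2 by blast
  then obtain c2 where c2: "ereal c1 < ereal c2" "ereal c2 < lower_density (multiples B)"
    using ereal_dense2 by blast
  define \<kappa> where "\<kappa> = (c2 - c1) / 2"
  have "\<kappa> > 0" using c2 by (simp add: \<kappa>_def)
  obtain A0 where A0: "finite A0" "A0 \<subseteq> A" "sift_density A0 < \<kappa> / 2"
    using small [of "\<kappa> / 2"] \<open>\<kappa> > 0\<close> by auto
  define A1 where "A1 = A0 - {a}"
  have zero: "0 \<notin> A" using pos by fastforce
  have A1: "finite A1" "0 \<notin> A1" "A1 \<subseteq> A" using A0 zero by (auto simp: A1_def)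
  have dA1: "sift_density A1 \<le> \<kappa>"
  proof -
    have "sift_density A1 * (1 / 2) \<le> sift_density A1 * sift_density {a}"
      using \<open>a \<ge> 2\<close> by (intro mult_left_mono sift_density_nonneg) (simp add: sift_density_singleton field_simps)
    also have "\<dots> \<le> sift_density (A1 \<union> {a})"
      using A1 \<open>a > 0\<close> by (intro sift_density_Un_ge) auto
    also have "\<dots> \<le> sift_density A0"
      using A1 \<open>a > 0\<close> by (intro sift_density_antimono) (auto simp: A1_def)
    finally show ?thesis using A0(3) by simp
  qed
  obtain C where C: "\<And>N. (\<Sum>x=1..N. sifted A1 x) \<le> real N * sift_density A1 + C"
    using sifted_sum_bounds [OF A1(1,2)] by metis
  let ?r = "\<lambda>B N. real (card (multiples B \<inter> {1..int N})) / real N"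
  have count: "real (card (multiples B \<inter> {1..int N}))
      \<le> real (card (multiples (B - {b}) \<inter> {1..int N})) + (real N * \<kappa> + C)" for N
  proof -
    define X where "X = {x\<in>{1..N}. g dvd x}"
    have "(\<Sum>x=1..N. sifted (B - {b}) x - sifted B x) \<le> (\<Sum>x=1..N. if g dvd x then sifted A1 (x div g) else 0)"
    proof (rule sum_mono)
      fix x
      show "sifted (B - {b}) x - sifted B x \<le> (if g dvd x then sifted A1 (x div g) else 0)"
      proof (cases "sifted (B - {b}) x = 1 \<and> sifted B x = 0")
        case True
        then have nd: "\<And>b'. b' \<in> B - {b} \<Longrightarrow> \<not> b' dvd x" and "b dvd x"
          by (auto simp: sifted_def of_bool_def split: if_splits)
        then have "g dvd x" by (auto simp: b_def dest: dvd_mult_left)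
        then obtain y where y: "x = g * y" by blast
        have "\<not> a' dvd y" if "a' \<in> A1" for a'
        proof
          assume "a' dvd y"
          then have "g * a' dvd x" by (simp add: y)
          moreover have "g * a' \<in> B - {b}" using that A1(3) A(1) \<open>g > 0\<close> by (auto simp: b_def A1_def)
          ultimately show False using nd by blast
        qed
        then show ?thesis using y \<open>g > 0\<close> by (simp add: sifted_def)
      next
        case False
        then have "sifted (B - {b}) x - sifted B x \<le> 0"
          using sifted_01 [of B x] by (auto simp: sifted_def)
        then show ?thesis using sifted_01 [of A1 "x div g"] by auto
      qed
    qed
    also have "\<dots> = (\<Sum>x\<in>X. sifted A1 (x div g))"
      by (rule sum.mono_neutral_cong_right) (auto simp: X_def)
    also have "\<dots> = (\<Sum>y\<in>(\<lambda>x. x div g) ` X. sifted A1 y)"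
      by (subst sum.reindex) (auto simp: X_def inj_on_def)
    also have "\<dots> \<le> (\<Sum>y=1..N. sifted A1 y)"
    proof (rule sum_mono2)
      show "(\<lambda>x. x div g) ` X \<subseteq> {1..N}"
      proof
        fix y assume "y \<in> (\<lambda>x. x div g) ` X"
        then have "g * y \<in> {1..N}" by (auto simp: X_def)
        moreover have "y \<le> g * y" using \<open>g > 0\<close> by simp
        ultimately show "y \<in> {1..N}"
          using order_trans [of y "g * y" N] by (cases "y = 0") auto
      qed
    qed (auto simp: sifted_01)
    also have "\<dots> \<le> real N * sift_density A1 + C" by (rule C)
    also have "\<dots> \<le> real N * \<kappa> + C" using dA1 by (simp add: mult_left_mono)
    finally show ?thesis by (simp add: card_multiples sum_subtractf)
  qed
  have "eventually (\<lambda>N. ereal c2 < ereal (?r B N)) sequentially"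
    using c2(2) unfolding lower_density_def by (rule less_LiminfD)
  moreover have "eventually (\<lambda>N. C / real N < \<kappa>) sequentially"
    using order_tendstoD(2) [OF lim_const_over_n \<open>\<kappa> > 0\<close>] .
  moreover have "eventually (\<lambda>N. N > (0 :: nat)) sequentially" by (rule eventually_gt_at_top)
  ultimately have "eventually (\<lambda>N. ereal c1 \<le> ereal (?r (B - {b}) N)) sequentially"
  proof eventually_elim
    case (elim N)
    have "?r B N \<le> ?r (B - {b}) N + \<kappa> + C / real N"
      using count [of N] elim(3) by (simp add: field_simps)
    then show ?case using elim by (simp add: \<kappa>_def field_simps)
  qed
  then have "ereal c1 \<le> lower_density (multiples (B - {b}))"
    unfolding lower_density_def by (rule Liminf_bounded)
  then show False using c1(1) by simp
qed

section \<open>Free integers in a residue class\<close>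

lemma modulus_le_of_cong_near:
  assumes "[c = c'] (mod n)" "c \<noteq> c'" "c \<le> c' + D" "c' \<le> c + (D :: nat)"
  shows "n \<le> D"
proof -
  have *: "n \<le> D" if "[y = x] (mod n)" "x < y" "y \<le> x + D" for x y
  proof -
    have "n dvd y - x" using that by (simp add: cong_altdef_nat)
    then have "n \<le> y - x" using that by (intro dvd_imp_le) auto
    then show ?thesis using that by simp
  qed
  show ?thesis
    using * [of c c'] * [of c' c] assms by (meson cong_sym linorder_neqE_nat)
qed

text \<open>
  The use of this condition is that a prime power dividing an element of \<open>B\<close> but not \<open>L\<close> must exceed \<open>T\<close>,
  so that it cannot divide a difference of two nearby integers.
\<close>
definition saturated :: "nat set \<Rightarrow> nat \<Rightarrow> nat \<Rightarrow> bool" where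
  "saturated B T L \<longleftrightarrow> (\<forall>b\<in>B. \<forall>t\<le>T. t dvd b \<longrightarrow> t dvd L)"

lemma saturated_dvd: "saturated B T L \<Longrightarrow> L dvd L' \<Longrightarrow> saturated B T L'"
  unfolding saturated_def by (meson dvd_trans)

text \<open>
  Put \<open>g = gcd c L\<close>.  All members of the class of \<open>c\<close> modulo \<open>L\<close> are \<open>g\<close> times a number that is coprime to
  \<open>L div g\<close>, so \<open>b\<close> can divide one of them only if its cofactor \<open>b div gcd b g\<close> is coprime to \<open>L div g\<close>.
  The residual set collects these cofactors; they are what is left to be sifted out of the class.
\<close>
definition residual :: "nat set \<Rightarrow> nat \<Rightarrow> nat \<Rightarrow> nat set" where
  "residual B L c = {a. \<exists>b\<in>B. a = b div gcd b (gcd c L) \<and> coprime a (L div gcd c L)}"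

lemma finite_residual: "finite B \<Longrightarrow> finite (residual B L c)"
  by (rule finite_subset [of _ "(\<lambda>b. b div gcd b (gcd c L)) ` B"]) (auto simp: residual_def)

lemma zero_notin_residual: "0 \<notin> B \<Longrightarrow> 0 \<notin> residual B L c"
  by (auto simp: residual_def dvd_div_eq_0_iff)

text \<open>
  Here \<open>s\<close> solves \<open>(L div g) * s = c div g\<close> modulo the residual moduli, so that, up to a unit,
  \<open>(c + L * x) div g\<close> is \<open>x + s\<close>: sifting the class by \<open>B\<close> becomes sifting the shifted variable by the
  residual set.
\<close>
lemma not_dvd_of_sifted_residual:
  assumes "\<And>a. a \<in> residual B L c \<Longrightarrow> [L div gcd c L * s = c div gcd c L] (mod a)"
    and "sifted (residual B L c) (x + s) = 1" "b \<in> B" "0 \<notin> B" "L > 0"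
  shows "\<not> b dvd c + L * x"
proof
  assume dvd: "b dvd c + L * x"
  define g where "g = gcd c L"
  define c' where "c' = c div g"
  define l where "l = L div g"
  have c: "c = g * c'" and L: "L = g * l" by (auto simp: g_def c'_def l_def)
  have "g > 0" using \<open>L > 0\<close> by (simp add: g_def)
  have cop: "coprime c' l" unfolding c'_def l_def g_def using \<open>L > 0\<close> by (intro div_gcd_coprime) auto
  define a where "a = b div gcd b g"
  have "b > 0" using assms by (metis gr0I)
  have "b dvd g * (c' + l * x)" using dvd c L by (simp add: algebra_simps)
  moreover have "gcd b g * a = b" "gcd b g * (g div gcd b g * (c' + l * x)) = g * (c' + l * x)"
    by (simp_all add: a_def mult.assoc [symmetric])
  ultimately have "gcd b g * a dvd gcd b g * (g div gcd b g * (c' + l * x))" by (simp only:)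
  then have "a dvd g div gcd b g * (c' + l * x)"
    using \<open>b > 0\<close> nat_mult_dvd_cancel1 [of "gcd b g"] by simp
  moreover have "coprime a (g div gcd b g)"
    unfolding a_def using \<open>b > 0\<close> by (intro div_gcd_coprime) auto
  ultimately have advd: "a dvd c' + l * x" by (simp add: coprime_dvd_mult_right_iff)
  have "coprime a l"
  proof (rule coprimeI)
    fix d assume d: "d dvd a" "d dvd l"
    then have "d dvd c' + l * x" "d dvd l * x" using advd by (auto intro: dvd_trans)
    then have "d dvd c'" using dvd_add_left_iff by blast
    then show "is_unit d" using cop d by (metis coprime_common_divisor)
  qed
  then have a: "a \<in> residual B L c"
    using assms(3) by (auto simp: residual_def a_def l_def g_def)
  have "[l * s = c'] (mod a)" using assms(1) [OF a] by (simp add: l_def c'_def g_def)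
  then have "[l * s + l * x = c' + l * x] (mod a)" by (intro cong_add) auto
  moreover have "[c' + l * x = 0] (mod a)" using advd by (simp add: cong_0_iff)
  ultimately have "[l * s + l * x = 0] (mod a)" by (rule cong_trans)
  then have "[l * (x + s) = 0] (mod a)" by (simp add: distrib_left add.commute)
  then have "a dvd x + s"
    using \<open>coprime a l\<close> by (simp add: cong_0_iff coprime_dvd_mult_right_iff)
  then show False using assms(2) a by (auto simp: sifted_def of_bool_def split: if_splits)
qed

text \<open>
  A prime \<open>p\<close> that still occurs in a cofactor for \<open>c\<close> does not divide \<open>L div g\<close>.  Hence \<open>g\<close>, and with it \<open>c\<close>,
  contains the full power \<open>p ^ v\<close> of \<open>p\<close> in \<open>L\<close>, while some \<open>b\<close> contains a higher one.
\<close>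
lemma residual_prime_power:
  assumes "p dvd a" "prime p" "a \<in> residual B L c" "L > 0" and "0 \<notin> B"
    and s: "[L div gcd c L * s = c div gcd c L] (mod a)"
  defines "v \<equiv> multiplicity p L"
  shows "p ^ v dvd c" "\<exists>b\<in>B. p ^ Suc v dvd b" "[L * s = c] (mod p ^ Suc v)"
proof -
  define g where "g = gcd c L"
  define l where "l = L div g"
  have L: "L = g * l" by (simp add: g_def l_def)
  have cg: "g * (c div g) = c" by (simp add: g_def)
  obtain b where b: "b \<in> B" "a = b div gcd b g" "coprime a l"
    using assms(3) by (auto simp: residual_def g_def l_def)
  have "\<not> p dvd l"
    using b(3) \<open>p dvd a\<close> \<open>prime p\<close> by (metis coprime_common_divisor not_prime_unit)
  then have "coprime (p ^ v) l" using \<open>prime p\<close> by (simp add: prime_imp_coprime)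
  moreover have "p ^ v dvd g * l" unfolding v_def L [symmetric] by (rule multiplicity_dvd)
  ultimately have vg: "p ^ v dvd g" by (simp add: coprime_dvd_mult_left_iff)
  then show "p ^ v dvd c" by (simp add: g_def)
  have pb: "p * gcd b g dvd b"
    using \<open>p dvd a\<close> b(2) by (metis dvd_div_mult_self gcd_dvd1 mult_dvd_mono dvd_refl)
  have "p ^ k dvd b" if "k \<le> Suc v" for k
    using that
  proof (induction k)
    case (Suc k)
    then have "p ^ k dvd g" using vg by (meson Suc_le_mono dvd_trans le_imp_power_dvd)
    then have "p ^ k dvd gcd b g" using Suc by simp
    then show ?case using pb by (metis dvd_trans mult_dvd_mono dvd_refl power_Suc)
  qed simp
  then show "\<exists>b\<in>B. p ^ Suc v dvd b" using b(1) by blast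
  have "[l * s = c div g] (mod p)"
    using s \<open>p dvd a\<close> unfolding g_def l_def by (rule cong_dvd_modulus_nat)
  then have "[g * (l * s) = g * (c div g)] (mod g * p)" by (rule cong_cmult_leftI)
  then have "[L * s = c] (mod g * p)" by (simp only: L cg mult.assoc)
  moreover have "p ^ Suc v dvd g * p" using vg by (simp add: mult.commute mult_dvd_mono)
  ultimately show "[L * s = c] (mod p ^ Suc v)" by (rule cong_dvd_modulus_nat)
qed

text \<open>
  If \<open>p\<close> occurs in the cofactors for both \<open>c\<close> and \<open>c'\<close>, then \<open>p ^ v\<close> divides \<open>c - c'\<close> and so is at most \<open>D\<close>,
  whereas saturation makes \<open>p ^ Suc v\<close> exceed \<open>k * D\<close>; comparing the two, \<open>p\<close> is large.  Shifts that agreed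
  modulo \<open>p\<close> would force \<open>p ^ Suc v\<close> to divide \<open>c - c'\<close>.
\<close>
lemma residual_shifts_separate:
  assumes "L > 0" "0 \<notin> B"
    and near: "c \<noteq> c'" "c \<le> c' + D" "c' \<le> c + D"
    and sat: "saturated B (k * D) L" and "k > 0"
    and p: "prime p" "a \<in> residual B L c" "p dvd a" "a' \<in> residual B L c'" "p dvd a'"
    and s: "[L div gcd c L * s = c div gcd c L] (mod a)"
    and s': "[L div gcd c' L * s' = c' div gcd c' L] (mod a')"
  shows "\<not> [s = s'] (mod p) \<and> k < p"
proof -
  define v where "v = multiplicity p L"
  note r = residual_prime_power [OF p(3,1,2) assms(1,2) s, folded v_def]
  note r' = residual_prime_power [OF p(5,1,4) assms(1,2) s', folded v_def]
  have "\<not> p ^ Suc v dvd L"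
    using p(1) \<open>L > 0\<close> unfolding v_def
    by (metis Suc_n_not_le_n multiplicity_geI not_gr_zero not_prime_unit power_dvd_iff_le_multiplicity)
  then have large: "k * D < p ^ Suc v" using r(2) sat unfolding saturated_def by (meson not_le)
  have "[c = c'] (mod p ^ v)" using r(1) r'(1) by (simp add: cong_def mod_eq_0_iff_dvd)
  then have "p ^ v \<le> D" using near by (rule modulus_le_of_cong_near)
  then have "k * p ^ v < p * p ^ v" using large by (metis le_less_trans mult_le_mono2 power_Suc)
  then have "k < p" by simp
  moreover have "\<not> [s = s'] (mod p)"
  proof
    assume "[s = s'] (mod p)"
    then have "[p ^ v * s = p ^ v * s'] (mod p ^ v * p)" by (rule cong_cmult_leftI)
    then have "[p ^ v * s = p ^ v * s'] (mod p ^ Suc v)" by (simp only: power_Suc2)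
    then have "[L div p ^ v * (p ^ v * s) = L div p ^ v * (p ^ v * s')] (mod p ^ Suc v)"
      by (rule cong_scalar_left)
    moreover have "L div p ^ v * p ^ v = L" by (simp add: v_def multiplicity_dvd)
    ultimately have "[L * s = L * s'] (mod p ^ Suc v)" by (simp only: mult.assoc [symmetric])
    then have "[c = c'] (mod p ^ Suc v)" using r(3) r'(3) by (meson cong_sym cong_trans)
    then have "p ^ Suc v \<le> D" using near by (rule modulus_le_of_cong_near)
    also have "D \<le> k * D" using \<open>k > 0\<close> by simp
    finally show False using large by simp
  qed
  ultimately show ?thesis by simp
qed

text \<open>
  The cofactors are sorted by the common divisor of \<open>b\<close> with \<open>gcd c L\<close>.  By the local condition \<open>1\<close> is not a
  cofactor, so tautness applies to each of the finitely many classes, and Behrend's inequality combines them.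
\<close>
lemma residual_density_bounded_below:
  assumes B: "B \<subseteq> {1..}" "taut B" and "L > 0"
    and local: "\<And>b. b \<in> B \<Longrightarrow> b dvd L \<Longrightarrow> \<not> b dvd c"
  obtains \<delta> where "\<delta> > 0"
    "\<And>B0. finite B0 \<Longrightarrow> B0 \<subseteq> B \<Longrightarrow> \<delta> \<le> sift_density (residual B0 L c)"
proof -
  define G where "G = {g. g dvd gcd c L}"
  define A where "A = (\<lambda>X g. {a. \<exists>b\<in>X. gcd b (gcd c L) = g \<and> a = b div g \<and> coprime a (L div gcd c L)})"
  have "finite G" unfolding G_def using \<open>L > 0\<close> by (intro finite_divisors_nat) auto
  have "\<exists>\<delta>>0. \<forall>A0. finite A0 \<longrightarrow> A0 \<subseteq> A B g \<longrightarrow> \<delta> \<le> sift_density A0" for g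
  proof -
    have gA: "(\<lambda>a. g * a) ` A B g \<subseteq> B"
    proof clarify
      fix a assume "a \<in> A B g"
      then obtain b where b: "b \<in> B" "gcd b (gcd c L) = g" "a = b div g" by (auto simp: A_def)
      then have "g dvd b" by auto
      then show "g * a \<in> B" using b by simp
    qed
    have "1 \<notin> A B g"
    proof
      assume "1 \<in> A B g"
      then obtain b where b: "b \<in> B" "gcd b (gcd c L) = g" "1 = b div g" by (auto simp: A_def)
      have "g dvd b" using b(2) by auto
      then have "b = g" using b(3) [symmetric] dvd_mult_div_cancel [of g b] by simp
      then have "b dvd gcd c L" using b(2) gcd_dvd2 [of b "gcd c L"] by simp
      then show False using local [OF b(1)] by simp
    qed
    then obtain \<delta> where "\<delta> > 0" "\<And>A0. finite A0 \<Longrightarrow> A0 \<subseteq> A B g \<Longrightarrow> \<delta> \<le> sift_density A0"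
      by (rule taut_sift_density_bounded_below [OF B gA]) blast
    then show ?thesis by blast
  qed
  then have "\<forall>g. \<exists>\<delta>. 0 < \<delta> \<and> (\<forall>A0. finite A0 \<longrightarrow> A0 \<subseteq> A B g \<longrightarrow> \<delta> \<le> sift_density A0)" by blast
  then obtain \<delta> where \<delta>: "\<forall>g. 0 < \<delta> g \<and> (\<forall>A0. finite A0 \<longrightarrow> A0 \<subseteq> A B g \<longrightarrow> \<delta> g \<le> sift_density A0)"
    by (rule choice [THEN exE])
  show thesis
  proof
    show "(\<Prod>g\<in>G. \<delta> g) > 0" using \<delta> by (intro prod_pos) auto
    fix B0 assume B0: "finite B0" "B0 \<subseteq> B"
    have fin: "finite (A B0 g)" for g
      by (rule finite_subset [of _ "(\<lambda>b. b div g) ` B0"]) (use B0 in \<open>auto simp: A_def\<close>)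
    have zero: "0 \<notin> A B0 g" for g
    proof
      assume "0 \<in> A B0 g"
      then obtain b where b: "b \<in> B0" "gcd b (gcd c L) = g" "0 = b div g" by (auto simp: A_def)
      then have "g dvd b" by auto
      then have "b = 0" using b(3) dvd_mult_div_cancel [of g b] by simp
      then show False using b(1) B0(2) B(1) by auto
    qed
    have "A B0 g \<subseteq> A B g" for g using B0(2) by (auto simp: A_def)
    then have "0 \<le> \<delta> g \<and> \<delta> g \<le> sift_density (A B0 g)" for g
      using \<delta> fin less_imp_le by metis
    then have "(\<Prod>g\<in>G. \<delta> g) \<le> (\<Prod>g\<in>G. sift_density (A B0 g))" by (intro prod_mono)
    also have "\<dots> \<le> sift_density (\<Union>g\<in>G. A B0 g)"
      using \<open>finite G\<close> fin zero by (rule sift_density_UN_ge)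
    also have "(\<Union>g\<in>G. A B0 g) = residual B0 L c"
    proof (rule subset_antisym; rule subsetI)
      fix a assume "a \<in> residual B0 L c"
      then obtain b where b: "b \<in> B0" "a = b div gcd b (gcd c L)" "coprime a (L div gcd c L)"
        by (auto simp: residual_def)
      then have "a \<in> A B0 (gcd b (gcd c L))" by (auto simp: A_def)
      moreover have "gcd b (gcd c L) \<in> G" unfolding G_def using gcd_dvd2 by blast
      ultimately show "a \<in> (\<Union>g\<in>G. A B0 g)" by (rule UN_I [rotated])
    qed (auto simp: A_def residual_def)
    finally show "(\<Prod>g\<in>G. \<delta> g) \<le> sift_density (residual B0 L c)" .
  qed
qed

text \<open>
  The local condition rules out the only obstruction: some \<open>b dvd L\<close> dividing a whole class.  The bound on the
  density of good \<open>j\<close> is uniform over finite \<open>B\<^sub>0 \<subseteq> B\<close>, so \<open>B\<^sub>0\<close> may be chosen afterwards, by the theorem of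
  Davenport and Erdos, such that the rest of \<open>B\<close> spoils fewer \<open>j\<close> than there are good ones.
\<close>
theorem exists_sifted_in_progression:
  assumes B: "B \<subseteq> {1..}" "taut B" and "finite R" "0 \<notin> R" "L > 0"
    and diam: "\<And>c c'. c \<in> R \<Longrightarrow> c' \<in> R \<Longrightarrow> c \<le> c' + D"
    and sat: "saturated B (2 * (card R)\<^sup>2 * D) L"
    and local: "\<And>b c. \<lbrakk>b \<in> B; b dvd L; c \<in> R\<rbrakk> \<Longrightarrow> \<not> b dvd c"
  obtains j where "\<And>c b. c \<in> R \<Longrightarrow> b \<in> B \<Longrightarrow> \<not> b dvd c + L * j"
proof (cases "R = {}")
  case False
  define m where "m = card R"
  have "m > 0" using False \<open>finite R\<close> by (simp add: m_def card_gt_0_iff)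
  have zB: "0 \<notin> B" using B(1) by auto
  have "\<forall>c\<in>R. \<exists>\<delta>. 0 < \<delta> \<and> (\<forall>B0. finite B0 \<longrightarrow> B0 \<subseteq> B \<longrightarrow> \<delta> \<le> sift_density (residual B0 L c))"
  proof
    fix c assume "c \<in> R"
    then obtain \<delta> where "\<delta> > 0"
      "\<And>B0. finite B0 \<Longrightarrow> B0 \<subseteq> B \<Longrightarrow> \<delta> \<le> sift_density (residual B0 L c)"
      using residual_density_bounded_below [OF B \<open>L > 0\<close>, of c] local by blast
    then show "\<exists>\<delta>. 0 < \<delta> \<and> (\<forall>B0. finite B0 \<longrightarrow> B0 \<subseteq> B \<longrightarrow> \<delta> \<le> sift_density (residual B0 L c))"
      by blast
  qed
  then obtain \<delta>' where "\<forall>c\<in>R. 0 < \<delta>' c \<and>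
      (\<forall>B0. finite B0 \<longrightarrow> B0 \<subseteq> B \<longrightarrow> \<delta>' c \<le> sift_density (residual B0 L c))"
    by (rule bchoice [THEN exE])
  then have \<delta>': "\<And>c. c \<in> R \<Longrightarrow> \<delta>' c > 0"
      "\<And>c B0. \<lbrakk>c \<in> R; finite B0; B0 \<subseteq> B\<rbrakk> \<Longrightarrow> \<delta>' c \<le> sift_density (residual B0 L c)"
    by auto
  define \<delta> where "\<delta> = (1 / 2) * (\<Prod>c\<in>R. \<delta>' c)"
  have "\<delta> > 0" using \<delta>'(1) by (simp add: \<delta>_def prod_pos)
  \<comment> \<open>Up to \<open>N\<close> there are about \<open>\<delta> * N / L\<close> good members of the progressions, and the tail of \<open>B\<close> may spoil
      half of them, summed over the \<open>m\<close> starting points.\<close>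
  define \<epsilon> where "\<epsilon> = \<delta> / (2 * real L * real m)"
  have "\<epsilon> > 0" using \<open>\<delta> > 0\<close> \<open>L > 0\<close> \<open>m > 0\<close> by (simp add: \<epsilon>_def)
  obtain B0 where B0: "finite B0" "B0 \<subseteq> B"
    and tail: "\<And>M. \<exists>N\<ge>M. (\<Sum>x=1..N. sifted B0 x - sifted B x) \<le> \<epsilon> * real N"
    by (rule davenport_erdos [OF zB \<open>\<epsilon> > 0\<close>]) blast
  have z0: "0 \<notin> B0" using zB B0 by auto
  define A where "A = residual B0 L"
  have finA: "finite (A c)" and zA: "0 \<notin> A c" for c
    using finite_residual [OF B0(1)] zero_notin_residual [OF z0] by (auto simp: A_def)
  define q where "q c = \<Prod>(A c)" for c
  have q: "a dvd q c" if "a \<in> A c" for a c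
    unfolding q_def using finA that by (rule dvd_prod_eqI) auto
  have "\<exists>s. [L div gcd c L * s = c div gcd c L] (mod q c)" for c
  proof -
    have "coprime (L div gcd c L) (q c)"
      unfolding q_def by (rule prod_coprime_right) (auto simp: A_def residual_def coprime_commute)
    then obtain x where "[L div gcd c L * x = 1] (mod q c)" using cong_solve_coprime_nat by auto
    then have "[L div gcd c L * x * (c div gcd c L) = 1 * (c div gcd c L)] (mod q c)"
      by (rule cong_mult) simp
    then show ?thesis by (metis mult.assoc mult_1)
  qed
  then obtain s where sq: "\<And>c. [L div gcd c L * s c = c div gcd c L] (mod q c)" by metis
  have s: "[L div gcd c L * s c = c div gcd c L] (mod a)" if "a \<in> A c" for a c
    using sq q [OF that] by (rule cong_dvd_modulus_nat)
  define Q where "Q = (\<Prod>c\<in>R. q c)"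
  have "Q > 0" unfolding Q_def q_def using zA by (auto intro!: prod_pos) (metis gr0I)
  have Qdvd: "a dvd Q" if "c \<in> R" "a \<in> A c" for a c
    unfolding Q_def using q [OF that(2)] dvd_prodI [OF \<open>finite R\<close> that(1)] by (rule dvd_trans)
  define F where "F = (\<lambda>x. \<Prod>c\<in>R. sifted (A c) (x + s c))"
  have F01: "0 \<le> F x" "F x \<le> 1" for x
    unfolding F_def by (auto intro!: prod_nonneg prod_le_1 simp: sifted_01)
  have per: "F (x mod Q) = F x" for x
  proof -
    have "sifted (A c) (x mod Q + s c) = sifted (A c) (x + s c)" if "c \<in> R" for c
      using sifted_periodic [of "A c" Q, OF Qdvd [OF that]] by (metis mod_add_left_eq)
    then show ?thesis by (simp add: F_def)
  qed
  have "\<delta> \<le> mean F Q"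
  proof -
    have "\<delta> \<le> (1 / 2) * (\<Prod>c\<in>R. mean (\<lambda>x. sifted (A c) (gcd x Q)) Q)"
    proof -
      have "\<delta>' c \<le> mean (\<lambda>x. sifted (A c) (gcd x Q)) Q" if "c \<in> R" for c
        using \<delta>'(2) [OF that B0] sift_density_eq [of "A c" Q] Qdvd [OF that] \<open>Q > 0\<close> sifted_gcd [of "A c" Q]
        by (simp add: A_def)
      then show ?thesis
        unfolding \<delta>_def using \<delta>'(1) by (intro mult_left_mono prod_mono) (auto intro: less_imp_le)
    qed
    also have "\<dots> \<le> mean (\<lambda>x. \<Prod>c\<in>R. sifted (A c) (gcd (x + s c) Q)) Q"
    proof (rule shifted_behrend_inequality [where R = "\<lambda>c. {p. \<exists>a\<in>A c. p dvd a}"])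
      fix c c' p
      assume c: "c \<in> R" "c' \<in> R" "c \<noteq> c'" "prime p"
        and "p \<in> {p. \<exists>a\<in>A c. p dvd a}" "p \<in> {p. \<exists>a\<in>A c'. p dvd a}"
      then obtain a a' where a: "a \<in> A c" "p dvd a" "a' \<in> A c'" "p dvd a'" by blast
      show "\<not> [s c = s c'] (mod p) \<and> 2 * (card R)\<^sup>2 < p"
      proof (rule residual_shifts_separate [where a = a and a' = a', OF \<open>L > 0\<close> z0 c(3) diam [OF c(1,2)] diam [OF c(2,1)]])
        show "saturated B0 (2 * (card R)\<^sup>2 * D) L"
          using sat B0(2) unfolding saturated_def by blast
      qed (use a c s \<open>m > 0\<close> in \<open>auto simp: A_def m_def\<close>)
    qed (use \<open>finite R\<close> \<open>Q > 0\<close> in \<open>auto simp: div_antitone_sifted blind_outside_sifted\<close>)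
    also have "\<dots> = mean F Q"
      unfolding F_def using Qdvd by (intro mean_cong prod.cong refl sifted_gcd) auto
    finally show ?thesis .
  qed
  define K where "K = Max R"
  have K: "c \<le> K" if "c \<in> R" for c using that \<open>finite R\<close> by (simp add: K_def)
  define E where "E = (\<lambda>x. sifted B0 x - sifted B x)"
  have E01: "E x = 0 \<or> E x = 1" for x using B0(2) by (auto simp: E_def sifted_def)
  have E0: "0 \<le> E x" for x using E01 [of x] by auto
  have "\<exists>j. F j \<noteq> 0 \<and> (\<forall>c\<in>R. E (c + L * j) = 0)"
  proof (rule ccontr)
    assume none: "\<not> ?thesis"
    have FE: "F j \<le> (\<Sum>c\<in>R. E (c + L * j))" for j
    proof (cases "F j = 0")
      case False
      then obtain c where c: "c \<in> R" "E (c + L * j) = 1" using none E01 by blast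
      have "F j \<le> E (c + L * j)" using F01 c by simp
      also have "\<dots> \<le> (\<Sum>c\<in>R. E (c + L * j))"
        using c(1) \<open>finite R\<close> E0 by (intro member_le_sum) auto
      finally show ?thesis .
    qed (simp add: sum_nonneg E0)
    obtain N where N: "N \<ge> K + nat \<lceil>2 * real L / \<delta> * (\<delta> * real K / real L + \<delta> + real Q + 1)\<rceil>"
      "(\<Sum>x=1..N. E x) \<le> \<epsilon> * real N" using tail unfolding E_def by meson
    define J where "J = (N - K) div L"
    have "real J * \<delta> - real Q \<le> real J * mean F Q - real Q"
      using \<open>\<delta> \<le> mean F Q\<close> by (simp add: mult_left_mono)
    also have "\<dots> \<le> (\<Sum>j<J. F j)"
      using sum_periodic_bounds(1) [of F Q, OF per \<open>Q > 0\<close> F01] .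
    also have "\<dots> \<le> (\<Sum>j<J. \<Sum>c\<in>R. E (c + L * j))" by (intro sum_mono FE)
    also have "\<dots> = (\<Sum>c\<in>R. \<Sum>j<J. E (c + L * j))" by (rule sum.swap)
    also have "\<dots> \<le> (\<Sum>c\<in>R. \<epsilon> * real N)"
    proof (rule sum_mono)
      fix c assume c: "c \<in> R"
      then have "c > 0" using \<open>0 \<notin> R\<close> by (metis gr0I)
      have "(\<Sum>j<J. E (c + L * j)) = (\<Sum>x\<in>(\<lambda>j. c + L * j) ` {..<J}. E x)"
        using \<open>L > 0\<close> by (subst sum.reindex) (auto simp: inj_on_def)
      also have "\<dots> \<le> (\<Sum>x=1..N. E x)"
      proof (rule sum_mono2)
        show "(\<lambda>j. c + L * j) ` {..<J} \<subseteq> {1..N}"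
        proof
          fix x assume "x \<in> (\<lambda>j. c + L * j) ` {..<J}"
          then obtain j where j: "j < J" "x = c + L * j" by blast
          have "L * j \<le> L * J" using j by simp
          also have "\<dots> \<le> N - K" by (simp add: J_def)
          finally show "x \<in> {1..N}" using j K [OF c] \<open>c > 0\<close> N(1) by simp
        qed
      qed (auto simp: E0)
      finally show "(\<Sum>j<J. E (c + L * j)) \<le> \<epsilon> * real N" using N(2) by simp
    qed
    also have "\<dots> = \<delta> * real N / (2 * real L)"
      using \<open>m > 0\<close> by (simp add: \<epsilon>_def m_def)
    finally have upper: "real J * \<delta> - real Q \<le> \<delta> * real N / (2 * real L)" .
    have "N - K < L * (J + 1)"
      unfolding J_def using \<open>L > 0\<close> by (metis Suc_eq_plus1 dividend_less_times_div mult.commute mult_Suc add.commute)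
    then have "real (N - K) \<le> real L * (real J + 1)"
      by (metis less_imp_le of_nat_1 of_nat_add of_nat_le_iff of_nat_mult)
    then have "real N - real K \<le> real L * (real J + 1)" using N(1) by simp
    then have "(real N - real K) / real L - 1 \<le> real J"
      using \<open>L > 0\<close> by (simp add: field_simps)
    then have "\<delta> * ((real N - real K) / real L - 1) \<le> \<delta> * real J"
      using \<open>\<delta> > 0\<close> by (intro mult_left_mono) auto
    with upper have "\<delta> * ((real N - real K) / real L - 1) - real Q \<le> \<delta> * real N / (2 * real L)"
      by (simp add: mult.commute)
    then have "\<delta> * real N / (2 * real L) \<le> \<delta> * real K / real L + \<delta> + real Q"
    proof -
      have "\<delta> * ((real N - real K) / real L - 1)
          = 2 * (\<delta> * real N / (2 * real L)) - \<delta> * real K / real L - \<delta>"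
        using \<open>L > 0\<close> by (simp add: field_simps)
      then show ?thesis using \<open>\<delta> * ((real N - real K) / real L - 1) - real Q \<le> \<delta> * real N / (2 * real L)\<close>
        by linarith
    qed
    then have "2 * real L / \<delta> * (\<delta> * real N / (2 * real L))
        \<le> 2 * real L / \<delta> * (\<delta> * real K / real L + \<delta> + real Q)"
      using \<open>\<delta> > 0\<close> by (intro mult_left_mono) auto
    then have "real N \<le> 2 * real L / \<delta> * (\<delta> * real K / real L + \<delta> + real Q)"
      using \<open>L > 0\<close> \<open>\<delta> > 0\<close> by simp
    also have "\<dots> < 2 * real L / \<delta> * (\<delta> * real K / real L + \<delta> + real Q + 1)"
      using \<open>L > 0\<close> \<open>\<delta> > 0\<close> by (intro mult_strict_left_mono) auto
    also have "\<dots> \<le> real N" using N(1) by linarith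
    finally show False by simp
  qed
  then obtain j where j: "F j \<noteq> 0" "\<And>c. c \<in> R \<Longrightarrow> E (c + L * j) = 0" by blast
  show thesis
  proof (rule that)
    fix c b assume c: "c \<in> R" and b: "b \<in> B"
    have "sifted (A c) (j + s c) \<noteq> 0" using j(1) c \<open>finite R\<close> by (auto simp: F_def)
    then have "sifted (residual B0 L c) (j + s c) = 1" by (auto simp: A_def sifted_def)
    then have "\<not> b' dvd c + L * j" if "b' \<in> B0" for b'
      using not_dvd_of_sifted_residual [of B0 L c "s c" j b'] s that z0 \<open>L > 0\<close> by (auto simp: A_def)
    then have "sifted B (c + L * j) = 1" using j(2) [OF c] by (simp add: E_def sifted_def)
    then show "\<not> b dvd c + L * j" using b by (auto simp: sifted_def of_bool_def split: if_splits)
  qed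
qed (use that in auto)

section \<open>Prescribing free and non-free positions\<close>

lemma obtain_saturating_set:
  obtains S where "finite S" "S \<subseteq> B" "saturated B T (Lcm S)"
proof -
  define X where "X = {t \<in> {..T}. \<exists>b\<in>B. t dvd b}"
  have "\<forall>t\<in>X. \<exists>b. b \<in> B \<and> t dvd b" by (auto simp: X_def)
  then obtain f where f: "\<forall>t\<in>X. f t \<in> B \<and> t dvd f t" by (rule bchoice [THEN exE])
  show thesis
  proof
    show "finite (f ` X)" by (simp add: X_def)
    show "f ` X \<subseteq> B" using f by auto
    show "saturated B T (Lcm (f ` X))"
      unfolding saturated_def
    proof (intro ballI allI impI)
      fix b t assume "b \<in> B" "t \<le> T" "t dvd b"
      then have "t \<in> X" by (auto simp: X_def)
      then show "t dvd Lcm (f ` X)" using f by (meson dvd_Lcm dvd_trans image_eqI)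
    qed
  qed
qed

lemma in_multiples_iff: "n \<in> multiples B \<longleftrightarrow> (\<exists>b\<in>B. int b dvd n)"
  by (auto simp: multiples_def dvd_def)

lemma cong_Lcm_int:
  assumes "\<And>b. b \<in> S \<Longrightarrow> [k = k'] (mod int b)"
  shows "[k = k'] (mod int (Lcm S))"
proof -
  have "b dvd nat \<bar>k - k'\<bar>" if "b \<in> S" for b
    using assms [OF that] by (simp add: cong_iff_dvd_diff)
  then have "Lcm S dvd nat \<bar>k - k'\<bar>" by (rule Lcm_least)
  then show ?thesis by (simp add: cong_iff_dvd_diff)
qed

lemma cong_dvd_iff_add:
  assumes "[k = k'] (mod int b)"
  shows "int b dvd k + n \<longleftrightarrow> int b dvd k' + n"
  using cong_add [OF assms cong_refl [of n]] by (rule cong_dvd_iff)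

lemma cong_dvd_modulus_int:
  assumes "[k = k'] (mod int L)" "b dvd L"
  shows "[k = k'] (mod int b)"
  using assms(1) by (rule cong_dvd_modulus) (use assms(2) in simp)

lemma exists_free_in_residue_class:
  assumes B: "B \<subseteq> {1..}" "taut B" and "L > 0"
    and P: "P \<subseteq> {- int N..int N}"
    and sat: "saturated B T L" "2 * (card P)\<^sup>2 * (2 * N) \<le> T"
    and local: "\<And>n b. \<lbrakk>n \<in> P; b \<in> B; b dvd L\<rbrakk> \<Longrightarrow> \<not> int b dvd r + n"
  shows "\<exists>k. [k = r] (mod int L) \<and> (\<forall>n\<in>P. k + n \<notin> multiples B)"
proof -
  define M where "M = \<bar>r\<bar> + int N + 1"
  \<comment> \<open>A representative so large that all \<open>r' + n\<close> are positive.\<close>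
  define r' where "r' = r + int L * M"
  have cong: "[r' = r] (mod int L)" by (simp add: r'_def cong_iff_dvd_diff)
  have "1 * M \<le> int L * M"
    using \<open>L > 0\<close> by (intro mult_right_mono) (auto simp: M_def)
  moreover have "int N < r + M" by (simp add: M_def)
  ultimately have "r' > int N" unfolding r'_def by linarith
  then have pos: "r' + n > 0" if "n \<in> P" for n using P that by force
  define R where "R = (\<lambda>n. nat (r' + n)) ` P"
  have finP: "finite P" using P finite_subset by blast
  have inj: "inj_on (\<lambda>n. nat (r' + n)) P" using pos by (fastforce simp: inj_on_def)
  have cardR: "card R = card P" unfolding R_def using inj by (rule card_image)
  obtain j where j: "\<And>c b. c \<in> R \<Longrightarrow> b \<in> B \<Longrightarrow> \<not> b dvd c + L * j"
  proof (rule exists_sifted_in_progression [OF B _ _ \<open>L > 0\<close>])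
    show "finite R" unfolding R_def using finP by simp
    show "0 \<notin> R" unfolding R_def using pos by fastforce
    show "c \<le> c' + 2 * N" if cc: "c \<in> R" "c' \<in> R" for c c'
    proof -
      obtain n n' where "n \<in> P" "c = nat (r' + n)" "n' \<in> P" "c' = nat (r' + n')"
        using cc unfolding R_def by blast
      moreover from this have "n \<le> int N" "- int N \<le> n'" using P by auto
      ultimately show ?thesis using pos [of n] pos [of n'] by linarith
    qed
    show "saturated B (2 * (card R)\<^sup>2 * (2 * N)) L"
      using sat unfolding saturated_def cardR by (meson order_trans)
    show "\<not> b dvd c" if bc: "b \<in> B" "b dvd L" "c \<in> R" for b c
    proof
      assume "b dvd c"
      obtain n where n: "n \<in> P" "c = nat (r' + n)" using bc(3) unfolding R_def by blast
      have "int b dvd int c" using \<open>b dvd c\<close> by simp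
      then have "int b dvd r' + n" using n pos [of n] by simp
      moreover have "[r' = r] (mod int b)"
        using cong bc(2) by (rule cong_dvd_modulus_int)
      ultimately show False using local [OF n(1) bc(1,2)] cong_dvd_iff_add [of r' r b n] by simp
    qed
  qed (rule that)
  show ?thesis
  proof (intro exI conjI ballI)
    show "[r' + int (L * j) = r] (mod int L)"
      using cong_add [OF cong, of "int (L * j)" 0] by (simp add: cong_0_iff)
    fix n assume n: "n \<in> P"
    show "r' + int (L * j) + n \<notin> multiples B"
    proof
      assume "r' + int (L * j) + n \<in> multiples B"
      then obtain b where b: "b \<in> B" "int b dvd r' + int (L * j) + n" by (auto simp: in_multiples_iff)
      have "r' + int (L * j) + n = int (nat (r' + n) + L * j)" using pos [OF n] by simp
      then have "b dvd nat (r' + n) + L * j" using b(2) by (metis int_dvd_int_iff)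
      then show False using j [OF _ b(1)] n by (auto simp: R_def)
    qed
  qed
qed

text \<open>
  Move from \<open>k\<close> to \<open>k'\<close> for the sake of \<open>n\<close> and pass to the modulus \<open>lcm L b\<close>.  A \<open>b'\<close> dividing this
  modulus as well as \<open>k' + n'\<close> has a small common divisor with \<open>b\<close>; by saturation that divisor already
  divides \<open>L\<close>, and then so does \<open>b'\<close>.  But modulo \<open>L\<close> nothing has changed, and \<open>k + n'\<close> is free.
\<close>
lemma force_multiple:
  assumes B: "B \<subseteq> {1..}" "taut B" and "L > 0"
    and P: "P \<subseteq> {- int N..int N}" and n: "n \<in> {- int N..int N}" "n \<notin> P"
    and sat: "saturated B T L" "2 * (card P)\<^sup>2 * (2 * N) \<le> T" "2 * N \<le> T"
    and k: "\<And>n'. n' \<in> P \<Longrightarrow> k + n' \<notin> multiples B"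
    and k': "[k' = k] (mod int L)" "b \<in> B" "int b dvd k' + n"
  shows "\<exists>k''. [k'' = k] (mod int L) \<and> int b dvd k'' + n \<and> (\<forall>n'\<in>P. k'' + n' \<notin> multiples B)"
proof -
  define L' where "L' = lcm L b"
  have "b > 0" using B(1) k'(2) by auto
  have "L' > 0" using \<open>L > 0\<close> \<open>b > 0\<close> by (simp add: L'_def lcm_pos_nat)
  have "L dvd L'" by (simp add: L'_def)
  have "\<not> int b' dvd k' + n'" if n': "n' \<in> P" and b': "b' \<in> B" "b' dvd L'" for n' b'
  proof
    assume dvd: "int b' dvd k' + n'"
    define t where "t = gcd b' b"
    have "int t dvd int b'" "int t dvd int b" by (simp_all add: t_def)
    then have "int t dvd (k' + n') - (k' + n)"
      using dvd k'(3) by (intro dvd_diff) (rule dvd_trans, assumption+)+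
    then have "int t dvd n' - n" by simp
    moreover have "n' - n \<noteq> 0" using n(2) n' by auto
    ultimately have "int t \<le> \<bar>n' - n\<bar>" using dvd_imp_le_int [of "n' - n" "int t"] by simp
    moreover have "\<bar>n' - n\<bar> \<le> 2 * int N" using P n n' by force
    ultimately have "t \<le> T" using sat(3) by linarith
    then have "t dvd L" using sat(1) k'(2) by (auto simp: saturated_def t_def)
    moreover have "b' = lcm (gcd b' L) t"
    proof -
      have "b' = gcd b' (lcm L b)" using b'(2) by (simp add: L'_def gcd_nat.absorb1)
      also have "\<dots> = lcm (gcd b' L) (gcd b' b)" by (rule gcd_lcm_distrib)
      finally show ?thesis by (simp add: t_def)
    qed
    ultimately have "b' dvd L" by (metis gcd_dvd2 lcm_least)
    with k'(1) have "[k' = k] (mod int b')" by (rule cong_dvd_modulus_int)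
    then have "int b' dvd k + n'" using dvd cong_dvd_iff_add [of k' k b' n'] by simp
    then show False using k [OF n'] b'(1) by (auto simp: in_multiples_iff)
  qed
  note local = this
  obtain k'' where k'': "[k'' = k'] (mod int L')" "\<forall>n'\<in>P. k'' + n' \<notin> multiples B"
    using exists_free_in_residue_class [OF B \<open>L' > 0\<close> P saturated_dvd [OF sat(1) \<open>L dvd L'\<close>] sat(2) local]
    by blast
  show ?thesis
  proof (intro exI conjI)
    have "[k'' = k'] (mod int L)"
      using k''(1) \<open>L dvd L'\<close> by (rule cong_dvd_modulus_int)
    then show "[k'' = k] (mod int L)" using k'(1) by (rule cong_trans)
    have "b dvd L'" by (simp add: L'_def)
    with k''(1) have "[k'' = k'] (mod int b)" by (rule cong_dvd_modulus_int)
    then show "int b dvd k'' + n" using k'(3) cong_dvd_iff_add [of k'' k' b n] by simp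
  qed (rule k''(2))
qed

text \<open>
  Here \<open>h\<close> stands for a point of the odometer given by its residues.  The density assumption expresses that
  near \<open>h + \<Delta>(n)\<close>, for \<open>n \<in> Z\<close>, the window has empty interior.
\<close>
theorem realise_pattern:
  assumes B: "B \<subseteq> {1..}" "taut B"
    and h: "\<And>S. finite S \<Longrightarrow> S \<subseteq> B \<Longrightarrow> \<exists>k. \<forall>b\<in>S. [k = h b] (mod int b)"
    and P: "finite P" "\<And>n b. n \<in> P \<Longrightarrow> b \<in> B \<Longrightarrow> \<not> int b dvd h b + n"
    and S0: "finite S0" "S0 \<subseteq> B"
    and Z: "finite Z" "P \<inter> Z = {}"
    and dense: "\<And>n k S. \<lbrakk>n \<in> Z; \<forall>b\<in>S0. [k = h b] (mod int b); finite S; S \<subseteq> B\<rbrakk> \<Longrightarrow>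
                  \<exists>k'. (\<forall>b\<in>S. [k' = k] (mod int b)) \<and> k' + n \<in> multiples B"
  shows "\<exists>k. (\<forall>n\<in>P. k + n \<notin> multiples B) \<and> (\<forall>n\<in>Z. k + n \<in> multiples B)"
proof -
  define N where "N = nat (Max (insert 0 (abs ` (P \<union> Z))))"
  have N: "n \<in> {- int N..int N}" if "n \<in> P \<union> Z" for n
  proof -
    have "\<bar>n\<bar> \<le> Max (insert 0 (abs ` (P \<union> Z)))" using that P(1) Z(1) by (intro Max_ge) auto
    then have "\<bar>n\<bar> \<le> int N" unfolding N_def by linarith
    then show ?thesis by (simp add: abs_le_iff)
  qed
  have PN: "P \<subseteq> {- int N..int N}" using N by blast
  \<comment> \<open>The first summand is what sieving in the progressions needs, for points at distance at most \<open>2 * N\<close>;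
      the second bounds \<open>n - n'\<close> when a position is forced.\<close>
  define T where "T = 2 * (card P)\<^sup>2 * (2 * N) + 2 * N"
  have T: "2 * (card P)\<^sup>2 * (2 * N) \<le> T" "2 * N \<le> T" by (simp_all add: T_def)
  obtain S1 where S1: "finite S1" "S1 \<subseteq> B" "saturated B T (Lcm S1)"
    by (rule obtain_saturating_set)
  have Lcm_pos: "Lcm S > 0" if "finite S" "S \<subseteq> B" for S
    using that B(1) by (intro Lcm_pos_nat) auto
  have sat: "saturated B T (Lcm S)" if "S1 \<subseteq> S" for S
    using S1(3) by (rule saturated_dvd) (rule Lcm_subset [OF that])
  have mod_Lcm: "[k = k'] (mod int b)" if "[k = k'] (mod int (Lcm S))" "b \<in> S" for k k' :: int and b S
    using that(1) dvd_Lcm [OF that(2)] by (rule cong_dvd_modulus_int)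
  have "\<exists>k. (\<forall>b\<in>S0. [k = h b] (mod int b)) \<and> (\<forall>n\<in>P. k + n \<notin> multiples B) \<and>
        (\<forall>n\<in>Z'. k + n \<in> multiples B)" if "Z' \<subseteq> Z" for Z'
    using finite_subset [OF that Z(1)] that
  proof (induction Z')
    case empty
    define S where "S = S0 \<union> S1"
    have S: "finite S" "S \<subseteq> B" using S0 S1 by (auto simp: S_def)
    \<comment> \<open>The approximation of \<open>h\<close> must be exact at every \<open>b\<close> dividing the modulus, not only at those in \<open>S\<close>, to
        yield the local condition.\<close>
    define S' where "S' = S \<union> {b \<in> B. b dvd Lcm S}"
    have "finite {b. b dvd Lcm S}" using Lcm_pos [OF S] by (intro finite_divisors_nat) auto
    then have "finite S'" "S' \<subseteq> B" using S by (auto simp: S'_def)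
    then obtain r where "\<forall>b\<in>S'. [r = h b] (mod int b)" using h [of S'] by blast
    then have r: "\<And>b. b \<in> S' \<Longrightarrow> [r = h b] (mod int b)" by blast
    have "\<not> int b dvd r + n" if "n \<in> P" "b \<in> B" "b dvd Lcm S" for n b
    proof -
      have "b \<in> S'" using that(2,3) by (simp add: S'_def)
      then show ?thesis using P(2) [OF that(1,2)] cong_dvd_iff_add [OF r, of b n] by blast
    qed
    note local = this
    have satS: "saturated B T (Lcm S)" by (rule sat) (simp add: S_def)
    obtain k where k: "[k = r] (mod int (Lcm S))" "\<forall>n\<in>P. k + n \<notin> multiples B"
      using exists_free_in_residue_class [OF B Lcm_pos [OF S] PN satS T(1) local] by blast
    have "[k = h b] (mod int b)" if "b \<in> S0" for b
      by (rule cong_trans [OF mod_Lcm [OF k(1)] r]) (use that in \<open>auto simp: S_def S'_def\<close>)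
    then show ?case using k(2) by blast
  next
    case (insert n Z')
    then obtain k where k: "\<forall>b\<in>S0. [k = h b] (mod int b)" "\<And>n. n \<in> P \<Longrightarrow> k + n \<notin> multiples B"
      "\<forall>n\<in>Z'. k + n \<in> multiples B" by blast
    obtain f where f: "\<forall>n\<in>Z'. f n \<in> B \<and> int (f n) dvd k + n"
      using bchoice [of Z' "\<lambda>n b. b \<in> B \<and> int b dvd k + n"] k(3) unfolding in_multiples_iff by blast
    \<comment> \<open>Including the divisors \<open>f n\<close> in the modulus preserves the positions that are already forced.\<close>
    define S where "S = S0 \<union> S1 \<union> f ` Z'"
    have S: "finite S" "S \<subseteq> B" using S0 S1 insert.hyps f by (auto simp: S_def)
    obtain k' where k': "\<forall>b\<in>S. [k' = k] (mod int b)" "k' + n \<in> multiples B"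
      using dense [OF _ k(1) S, of n] insert.prems by blast
    then obtain b where b: "b \<in> B" "int b dvd k' + n" by (auto simp: in_multiples_iff)
    have nP: "n \<in> {- int N..int N}" "n \<notin> P" using insert.prems Z(2) N by auto
    have kk': "[k' = k] (mod int (Lcm S))" by (rule cong_Lcm_int) (rule k'(1) [THEN bspec])
    have satS: "saturated B T (Lcm S)" by (rule sat) (auto simp: S_def)
    obtain k'' where k'': "[k'' = k] (mod int (Lcm S))" "int b dvd k'' + n"
      "\<forall>n'\<in>P. k'' + n' \<notin> multiples B"
      using force_multiple [OF B Lcm_pos [OF S] PN nP satS T k(2) kk' b] by blast
    have "[k'' = h b'] (mod int b')" if "b' \<in> S0" for b'
      by (rule cong_trans [OF mod_Lcm [OF k''(1)]]) (use that k(1) in \<open>auto simp: S_def\<close>)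
    moreover have "k'' + n' \<in> multiples B" if "n' \<in> Z'" for n'
    proof -
      have "f n' \<in> S" using that by (simp add: S_def)
      then have "[k'' = k] (mod int (f n'))" using mod_Lcm [OF k''(1)] by blast
      then show ?thesis
        using f that cong_dvd_iff_add [of k'' k "f n'" n'] unfolding in_multiples_iff by blast
    qed
    moreover have "k'' + n \<in> multiples B" using k''(2) b(1) by (auto simp: in_multiples_iff)
    ultimately show ?case using k''(3) by blast
  qed
  then show ?thesis by blast
qed

section \<open>Products of discrete spaces\<close>

lemma openin_discrete_productD:
  assumes "openin (product_topology (\<lambda>i. discrete_topology (D i)) I) U" "x \<in> U"
  shows "\<exists>F. finite F \<and> F \<subseteq> I \<and> (\<forall>y\<in>PiE I D. (\<forall>i\<in>F. y i = x i) \<longrightarrow> y \<in> U)"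
proof -
  obtain V where V: "finite {i \<in> I. V i \<noteq> topspace (discrete_topology (D i))}"
      "x \<in> PiE I V" "PiE I V \<subseteq> U"
    using bspec [OF assms(1) [unfolded openin_product_topology_alt] assms(2)]
    by (elim exE conjE) (rule that)
  let ?F = "{i \<in> I. V i \<noteq> D i}"
  have 1: "finite ?F" using V(1) by simp
  have 2: "?F \<subseteq> I" by blast
  have 3: "\<forall>y\<in>PiE I D. (\<forall>i\<in>?F. y i = x i) \<longrightarrow> y \<in> U"
  proof (intro ballI impI)
    fix y assume y: "y \<in> PiE I D" "\<forall>i\<in>?F. y i = x i"
    have "y \<in> PiE I V"
    proof (rule PiE_I)
      fix i assume i: "i \<in> I"
      show "y i \<in> V i"
      proof (cases "V i = D i")
        case True
        then show ?thesis using PiE_mem [OF y(1) i] by simp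
      next
        case False
        then have "y i = x i" using y(2) i by blast
        then show ?thesis using PiE_mem [OF V(2) i] by simp
      qed
    next
      fix i assume "i \<notin> I"
      with y(1) show "y i = undefined" by (rule PiE_arb)
    qed
    then show "y \<in> U" using V(3) by (rule subsetD [rotated])
  qed
  show ?thesis using 1 2 3 by (intro exI [of _ ?F] conjI)
qed

lemma openin_discrete_cylinder:
  assumes "finite F" "F \<subseteq> I"
  shows "openin (product_topology (\<lambda>i. discrete_topology (D i)) I) {y \<in> PiE I D. \<forall>i\<in>F. y i = x i}"
proof -
  define V where "V = (\<lambda>i. if i \<in> F then {x i} \<inter> D i else D i)"
  have "{y \<in> PiE I D. \<forall>i\<in>F. y i = x i} = PiE I V"
  proof (rule subset_antisym; rule subsetI)
    fix y assume y: "y \<in> {y \<in> PiE I D. \<forall>i\<in>F. y i = x i}"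
    show "y \<in> PiE I V"
    proof (rule PiE_I)
      fix i assume "i \<in> I"
      moreover have "y \<in> PiE I D" using y by simp
      ultimately have yD: "y i \<in> D i" by (rule PiE_mem [rotated])
      show "y i \<in> V i"
      proof (cases "i \<in> F")
        case True
        moreover have "y i = x i" using y True by simp
        ultimately show ?thesis using yD by (simp add: V_def)
      qed (simp add: V_def yD)
    next
      fix i assume "i \<notin> I"
      moreover have "y \<in> PiE I D" using y by simp
      ultimately show "y i = undefined" by (rule PiE_arb [rotated])
    qed
  next
    fix y assume y: "y \<in> PiE I V"
    have "y i = x i" if "i \<in> F" for i
    proof -
      have "y i \<in> V i" using y subsetD [OF assms(2) that] by (rule PiE_mem)
      then show ?thesis using that by (simp add: V_def)
    qed
    moreover have "PiE I V \<subseteq> PiE I D" by (rule PiE_mono) (simp add: V_def)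
    ultimately show "y \<in> {y \<in> PiE I D. \<forall>i\<in>F. y i = x i}" using y by (simp add: subsetD)
  qed
  moreover have "openin (product_topology (\<lambda>i. discrete_topology (D i)) I) (PiE I V)"
  proof (rule product_topology_basis)
    show "openin (discrete_topology (D i)) (V i)" for i by (simp add: V_def)
    have "{i. V i \<noteq> topspace (discrete_topology (D i))} \<subseteq> F"
    proof
      fix i assume "i \<in> {i. V i \<noteq> topspace (discrete_topology (D i))}"
      then show "i \<in> F" by (cases "i \<in> F") (simp_all add: V_def)
    qed
    then show "finite {i. V i \<noteq> topspace (discrete_topology (D i))}"
      using assms(1) by (rule finite_subset)
  qed
  ultimately show ?thesis by simp
qed

lemma in_closure_of_discrete_product:
  assumes A: "A \<subseteq> PiE I D"
  shows "x \<in> product_topology (\<lambda>i. discrete_topology (D i)) I closure_of A \<longleftrightarrow>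
     x \<in> PiE I D \<and> (\<forall>F. finite F \<and> F \<subseteq> I \<longrightarrow> (\<exists>y\<in>A. \<forall>i\<in>F. y i = x i))"
    (is "?L \<longleftrightarrow> ?R")
proof
  let ?X = "product_topology (\<lambda>i. discrete_topology (D i)) I"
  assume L: ?L
  then have x: "x \<in> PiE I D" using closure_of_subset_topspace [of ?X A] by auto
  have "\<exists>y\<in>A. \<forall>i\<in>F. y i = x i" if F: "finite F" "F \<subseteq> I" for F
  proof -
    let ?C = "{y \<in> PiE I D. \<forall>i\<in>F. y i = x i}"
    have "x \<in> ?C \<and> openin ?X ?C \<longrightarrow> (\<exists>y. y \<in> A \<and> y \<in> ?C)"
      using L unfolding in_closure_of by (elim conjE) (erule spec)
    moreover have "x \<in> ?C" using x by simp
    ultimately show ?thesis using openin_discrete_cylinder [OF F, of D x] by blast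
  qed
  then show ?R using x by blast
next
  let ?X = "product_topology (\<lambda>i. discrete_topology (D i)) I"
  assume R: ?R
  have "\<exists>y. y \<in> A \<and> y \<in> U" if U: "x \<in> U \<and> openin ?X U" for U
  proof -
    obtain F where F: "finite F" "F \<subseteq> I" "\<forall>y\<in>PiE I D. (\<forall>i\<in>F. y i = x i) \<longrightarrow> y \<in> U"
      using openin_discrete_productD [OF conjunct2 [OF U] conjunct1 [OF U]] by (elim exE conjE)
    then obtain y where y: "y \<in> A" "\<forall>i\<in>F. y i = x i" using R by blast
    then have "y \<in> U" using F(3) A by blast
    then show ?thesis using y(1) by blast
  qed
  then show ?L using R unfolding in_closure_of topspace_product_topology by simp
qed

section \<open>The odometer and the window\<close>

context
  fixes B :: "nat set"
  assumes B: "B \<subseteq> {1..}"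
begin

lemma carrier_residue: "b \<in> B \<Longrightarrow> carrier (integer_mod_group b) = {0..<int b}"
  using B by (auto simp: carrier_integer_mod_group)

lemma Delta_in_product: "Delta B n \<in> PiE B (\<lambda>b. carrier (integer_mod_group b))"
proof (rule PiE_I)
  fix b assume b: "b \<in> B"
  then have "b > 0" using B by auto
  then show "Delta B n b \<in> carrier (integer_mod_group b)"
    using b by (simp add: Delta_def carrier_residue)
qed (simp add: Delta_def)

lemma in_odometer_iff:
  "h \<in> odometer B \<longleftrightarrow> h \<in> PiE B (\<lambda>b. carrier (integer_mod_group b)) \<and>
     (\<forall>F. finite F \<and> F \<subseteq> B \<longrightarrow> (\<exists>k. \<forall>b\<in>F. k mod int b = h b))"
proof -
  have "range (Delta B) \<subseteq> PiE B (\<lambda>b. carrier (integer_mod_group b))"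
    using Delta_in_product by blast
  then have closure: "h \<in> odometer B \<longleftrightarrow> h \<in> PiE B (\<lambda>b. carrier (integer_mod_group b)) \<and>
     (\<forall>F. finite F \<and> F \<subseteq> B \<longrightarrow> (\<exists>y\<in>range (Delta B). \<forall>b\<in>F. y b = h b))"
    unfolding odometer_def residue_product_topology_def by (rule in_closure_of_discrete_product)
  have "(\<exists>y\<in>range (Delta B). \<forall>b\<in>F. y b = h b) \<longleftrightarrow> (\<exists>k. \<forall>b\<in>F. k mod int b = h b)"
    if "F \<subseteq> B" for F
  proof -
    have "Delta B k b = k mod int b" if "b \<in> F" for k b
      using that \<open>F \<subseteq> B\<close> by (auto simp: Delta_def)
    then show ?thesis by simp
  qed
  then show ?thesis
    unfolding closure by (intro conj_cong refl iff_allI imp_cong) (elim conjE)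
qed

lemma translate_apply:
  "b \<in> B \<Longrightarrow> (h \<otimes>\<^bsub>residue_product B\<^esub> Delta B n) b = (h b + n) mod int b"
  by (simp add: residue_product_def product_group_def Delta_def mod_add_right_eq)

lemma translate_in_odometer:
  assumes "h \<in> odometer B"
  shows "h \<otimes>\<^bsub>residue_product B\<^esub> Delta B n \<in> odometer B"
  unfolding in_odometer_iff
proof (intro conjI allI impI)
  show "h \<otimes>\<^bsub>residue_product B\<^esub> Delta B n \<in> PiE B (\<lambda>b. carrier (integer_mod_group b))"
  proof (rule PiE_I)
    fix b assume b: "b \<in> B"
    then have "b > 0" using B by auto
    then show "(h \<otimes>\<^bsub>residue_product B\<^esub> Delta B n) b \<in> carrier (integer_mod_group b)"
      using b by (simp add: translate_apply carrier_residue)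
  qed (simp add: residue_product_def product_group_def)
  fix F assume F: "finite F \<and> F \<subseteq> B"
  then obtain k where k: "\<forall>b\<in>F. k mod int b = h b" using assms unfolding in_odometer_iff by blast
  have "(k + n) mod int b = (h \<otimes>\<^bsub>residue_product B\<^esub> Delta B n) b" if "b \<in> F" for b
  proof -
    have "b \<in> B" using that F by blast
    have "(k + n) mod int b = (k mod int b + n) mod int b" by (simp add: mod_add_left_eq)
    also have "\<dots> = (h b + n) mod int b" using k that by simp
    finally show ?thesis using translate_apply [OF \<open>b \<in> B\<close>] by simp
  qed
  then show "\<exists>k. \<forall>b\<in>F. k mod int b = (h \<otimes>\<^bsub>residue_product B\<^esub> Delta B n) b" by blast
qed

lemma openin_odometer_cylinder:
  assumes "finite F" "F \<subseteq> B"
  shows "openin (odometer_topology B) {g \<in> odometer B. \<forall>b\<in>F. g b = h b}"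
proof -
  let ?P = "PiE B (\<lambda>b. carrier (integer_mod_group b))"
  have "odometer B \<subseteq> ?P" by (simp add: in_odometer_iff subset_iff)
  then have eq: "{g \<in> odometer B. \<forall>b\<in>F. g b = h b} = {g \<in> ?P. \<forall>b\<in>F. g b = h b} \<inter> odometer B"
    by blast
  have "openin (residue_product_topology B) {g \<in> ?P. \<forall>b\<in>F. g b = h b}"
    unfolding residue_product_topology_def by (rule openin_discrete_cylinder [OF assms])
  then show ?thesis
    unfolding odometer_topology_def openin_subtopology using eq by (intro exI conjI) assumption+
qed

lemma topspace_odometer: "topspace (odometer_topology B) = odometer B"
proof -
  have "odometer B \<subseteq> PiE B (\<lambda>b. carrier (integer_mod_group b))"
    by (simp add: in_odometer_iff subset_iff)
  then show ?thesis
    by (simp add: odometer_topology_def topspace_subtopology residue_product_topology_def Int_absorb1)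
qed

text \<open>The window is closed, since a vanishing coordinate persists in a neighbourhood.\<close>
lemma window'_subset_window: "window' B \<subseteq> window B"
proof
  fix h assume h: "h \<in> window' B"
  then have "h \<in> topspace (odometer_topology B)"
    unfolding window'_def by (rule subsetD [OF closure_of_subset_topspace])
  then have hO: "h \<in> odometer B" by (simp add: topspace_odometer)
  show "h \<in> window B"
  proof (rule ccontr)
    assume "h \<notin> window B"
    then obtain b where b: "b \<in> B" "h b = 0" using hO unfolding window_def by auto
    let ?C = "{g \<in> odometer B. \<forall>b'\<in>{b}. g b' = h b'}"
    have "\<forall>T. h \<in> T \<and> openin (odometer_topology B) T \<longrightarrow>
        (\<exists>g. g \<in> odometer_topology B interior_of window B \<and> g \<in> T)"
      using h unfolding window'_def in_closure_of by (rule conjunct2)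
    then have "h \<in> ?C \<and> openin (odometer_topology B) ?C \<longrightarrow>
        (\<exists>g. g \<in> odometer_topology B interior_of window B \<and> g \<in> ?C)"
      by (rule spec)
    moreover have "openin (odometer_topology B) ?C"
      using b(1) by (intro openin_odometer_cylinder) auto
    ultimately obtain g where "g \<in> odometer_topology B interior_of window B" "g b = h b"
      using hO by blast
    then have "g \<in> window B" "g b = 0"
      using subsetD [OF interior_of_subset] b(2) by simp_all
    then show False using b(1) by (simp add: window_def)
  qed
qed

text \<open>
  Outside \<open>W'\<close> there is a neighbourhood containing no interior point of the window.  Any integer \<open>k\<close> in it is therefore
  approximated by points outside the window, and these in turn by multiples of elements of \<open>B\<close>.
\<close>
lemma window'_complement_locally_dense:
  assumes h: "h \<in> odometer B" "h \<notin> window' B"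
  shows "\<exists>F. finite F \<and> F \<subseteq> B \<and>
    (\<forall>k S. (\<forall>b\<in>F. k mod int b = h b) \<and> finite S \<and> S \<subseteq> B \<longrightarrow>
        (\<exists>k'. (\<forall>b\<in>S. [k' = k] (mod int b)) \<and> k' \<in> multiples B))"
proof -
  let ?int = "odometer_topology B interior_of window B"
  have zB: "0 \<notin> B" using B by auto
  obtain T where T: "openin (odometer_topology B) T" "h \<in> T" "\<forall>g\<in>T. g \<notin> ?int"
    using h unfolding window'_def in_closure_of topspace_odometer by blast
  obtain U where U: "openin (residue_product_topology B) U" "T = U \<inter> odometer B"
    using T(1) unfolding odometer_topology_def openin_subtopology by (elim exE conjE)
  have "h \<in> U" using T(2) U(2) by simp
  obtain F where F: "finite F" "F \<subseteq> B"
    "\<forall>y\<in>PiE B (\<lambda>b. carrier (integer_mod_group b)). (\<forall>b\<in>F. y b = h b) \<longrightarrow> y \<in> U"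
    using openin_discrete_productD [OF U(1) [unfolded residue_product_topology_def] \<open>h \<in> U\<close>]
    by (elim exE conjE)
  have "\<exists>k'. (\<forall>b\<in>S. [k' = k] (mod int b)) \<and> k' \<in> multiples B"
    if k: "\<forall>b\<in>F. k mod int b = h b" and S: "finite S" "S \<subseteq> B" for k S
  proof -
    have "\<forall>b\<in>F. Delta B k b = h b" using k F(2) by (simp add: Delta_def subset_iff)
    then have "Delta B k \<in> U" using F(3) Delta_in_product [of k] by simp
    then have "Delta B k \<in> T" using Delta_in_odometer [OF zB, of k] by (simp add: U(2))
    then have not_int: "Delta B k \<notin> ?int" using T(3) by simp
    let ?C = "{g \<in> odometer B. \<forall>b\<in>S. g b = Delta B k b}"
    have "\<not> ?C \<subseteq> window B"
    proof
      assume "?C \<subseteq> window B"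
      then have "?C \<subseteq> ?int" using openin_odometer_cylinder [OF S] by (rule interior_of_maximal)
      moreover have "Delta B k \<in> ?C" using Delta_in_odometer [OF zB, of k] by simp
      ultimately have "Delta B k \<in> ?int" by (rule subsetD)
      then show False using not_int by simp
    qed
    then obtain g where g: "g \<in> odometer B" "\<forall>b\<in>S. g b = Delta B k b" "g \<notin> window B" by blast
    have "\<not> (\<forall>b\<in>B. g b \<noteq> 0)" using g(1,3) by (simp add: window_def)
    then obtain b where b: "b \<in> B" "g b = 0" by blast
    have "finite (insert b S) \<and> insert b S \<subseteq> B" using S b(1) by simp
    then have "\<exists>k'. \<forall>c\<in>insert b S. k' mod int c = g c"
      by (rule mp [OF spec [OF conjunct2 [OF g(1) [unfolded in_odometer_iff]]]])
    then obtain k' where k': "\<forall>c\<in>insert b S. k' mod int c = g c" ..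
    have "[k' = k] (mod int c)" if "c \<in> S" for c
    proof -
      have "c \<in> B" using that S(2) by blast
      have "k' mod int c = g c" using k' that by blast
      also have "\<dots> = Delta B k c" using g(2) that by blast
      also have "\<dots> = k mod int c" using \<open>c \<in> B\<close> by (simp add: Delta_def)
      finally show ?thesis by (simp add: cong_def)
    qed
    moreover have "k' mod int b = 0" using bspec [OF k', of b] b(2) by simp
    then have "int b dvd k'" by (rule mod_0_imp_dvd)
    then have "k' \<in> multiples B" using b(1) unfolding in_multiples_iff by blast
    ultimately show ?thesis by (intro exI [of _ k'] conjI ballI)
  qed
  then show ?thesis using F(1,2) by (intro exI [of _ F]) simp
qed

lemma Delta_in_window_iff: "Delta B n \<in> window B \<longleftrightarrow> n \<notin> multiples B"
proof -
  have "0 \<notin> B" using B by auto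
  then show ?thesis
    using Delta_in_odometer [of B n]
    by (simp add: window_def Delta_def in_multiples_iff dvd_eq_mod_eq_0)
qed

lemma coding_in_full_shift: "coding B A h \<in> PiE UNIV (\<lambda>_. {0, 1})"
  by (simp add: coding_def PiE_iff)

theorem coding_interval_subset_X_eta:
  assumes "taut B"
  shows "coding_interval B \<subseteq> X_eta B"
proof
  fix x assume "x \<in> coding_interval B"
  then obtain h where x: "x \<in> PiE UNIV (\<lambda>_. {0, 1})" and h: "h \<in> odometer B"
    and lower: "coding B (window' B) h \<le> x" and upper: "x \<le> coding B (window B) h"
    unfolding coding_interval_def full_shift_def by auto
  let ?t = "\<lambda>n. h \<otimes>\<^bsub>residue_product B\<^esub> Delta B n"
  have x01: "x n = 0 \<or> x n = 1" for n using PiE_mem [OF x, of n] by simp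
  have in_window: "?t n \<in> window B" if "x n = 1" for n
    using le_funD [OF upper, of n] that by (simp add: coding_def split: if_splits)
  have notin_window': "?t n \<notin> window' B" if "x n = 0" for n
    using le_funD [OF lower, of n] that by (simp add: coding_def split: if_splits)
  have tO: "?t n \<in> odometer B" for n using h by (rule translate_in_odometer)
  have "\<exists>y\<in>coding B (window B) ` range (Delta B). \<forall>n\<in>F. y n = x n" if F: "finite F" for F
  proof -
    \<comment> \<open>Where \<open>x\<close> is \<open>1\<close> the upper bound puts \<open>h + \<Delta>(n)\<close> into the window; where \<open>x\<close> is \<open>0\<close> the lower bound keeps
        it outside \<open>W'\<close>.\<close>
    define P where "P = {n \<in> F. x n = 1}"
    define Z where "Z = {n \<in> F. x n = 0}"
    have "\<forall>n\<in>Z. \<exists>S. finite S \<and> S \<subseteq> B \<and>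
        (\<forall>k S'. (\<forall>b\<in>S. k mod int b = ?t n b) \<and> finite S' \<and> S' \<subseteq> B \<longrightarrow>
          (\<exists>k'. (\<forall>b\<in>S'. [k' = k] (mod int b)) \<and> k' \<in> multiples B))"
    proof
      fix n assume "n \<in> Z"
      then have "?t n \<notin> window' B" using notin_window' by (simp add: Z_def)
      with tO show "\<exists>S. finite S \<and> S \<subseteq> B \<and>
        (\<forall>k S'. (\<forall>b\<in>S. k mod int b = ?t n b) \<and> finite S' \<and> S' \<subseteq> B \<longrightarrow>
          (\<exists>k'. (\<forall>b\<in>S'. [k' = k] (mod int b)) \<and> k' \<in> multiples B))"
        by (rule window'_complement_locally_dense)
    qed
    then obtain S where "\<forall>n\<in>Z. finite (S n) \<and> S n \<subseteq> B \<and>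
        (\<forall>k S'. (\<forall>b\<in>S n. k mod int b = ?t n b) \<and> finite S' \<and> S' \<subseteq> B \<longrightarrow>
          (\<exists>k'. (\<forall>b\<in>S'. [k' = k] (mod int b)) \<and> k' \<in> multiples B))"
      by (rule bchoice [THEN exE])
    then have S: "\<And>n. n \<in> Z \<Longrightarrow> finite (S n)" "\<And>n. n \<in> Z \<Longrightarrow> S n \<subseteq> B"
      and S_dense: "\<And>n k S'. \<lbrakk>n \<in> Z; \<forall>b\<in>S n. k mod int b = ?t n b; finite S'; S' \<subseteq> B\<rbrakk> \<Longrightarrow>
          \<exists>k'. (\<forall>b\<in>S'. [k' = k] (mod int b)) \<and> k' \<in> multiples B"
      by blast+
    have "\<exists>k. (\<forall>n\<in>P. k + n \<notin> multiples B) \<and> (\<forall>n\<in>Z. k + n \<in> multiples B)"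
    proof (rule realise_pattern [OF B \<open>taut B\<close>, where h = h and ?S0.0 = "\<Union>n\<in>Z. S n"])
      fix S' assume "finite S'" "S' \<subseteq> B"
      then have "\<exists>k. \<forall>b\<in>S'. k mod int b = h b"
        using spec [OF conjunct2 [OF h [unfolded in_odometer_iff]], of S'] by simp
      then obtain k where k: "\<forall>b\<in>S'. k mod int b = h b" ..
      have "[k = h b] (mod int b)" if "b \<in> S'" for b
        unfolding bspec [OF k that, symmetric] by (simp add: cong_def)
      then show "\<exists>k. \<forall>b\<in>S'. [k = h b] (mod int b)" by blast
    next
      fix n b assume n: "n \<in> P" and b: "b \<in> B"
      have "?t n \<in> window B" using n in_window by (simp add: P_def)
      then have "?t n b \<noteq> 0" using b by (simp add: window_def)
      then show "\<not> int b dvd h b + n" using translate_apply [OF b] by (simp add: dvd_eq_mod_eq_0)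
    next
      fix n k S'
      assume n: "n \<in> Z" and k: "\<forall>b\<in>\<Union>n\<in>Z. S n. [k = h b] (mod int b)"
        and S': "finite S'" "S' \<subseteq> B"
      have "(k + n) mod int b = ?t n b" if "b \<in> S n" for b
      proof -
        have "b \<in> B" using S(2) [OF n] that by blast
        have "[k = h b] (mod int b)" using k n that by blast
        then have "[k + n = h b + n] (mod int b)" by (rule cong_add [OF _ cong_refl])
        then show ?thesis using translate_apply [OF \<open>b \<in> B\<close>] by (simp add: cong_def)
      qed
      then obtain k' where k': "\<forall>b\<in>S'. [k' = k + n] (mod int b)" "k' \<in> multiples B"
        using S_dense [OF n _ S', of "k + n"] by blast
      have "[k' - n = k] (mod int b)" if "b \<in> S'" for b
        using cong_diff [OF k'(1) [rule_format, OF that] cong_refl [of n]] by simp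
      moreover have "k' - n + n \<in> multiples B" using k'(2) by simp
      ultimately show "\<exists>k'. (\<forall>b\<in>S'. [k' = k] (mod int b)) \<and> k' + n \<in> multiples B" by blast
    next
      show "finite (\<Union>n\<in>Z. S n)" "(\<Union>n\<in>Z. S n) \<subseteq> B" using S F by (auto simp: Z_def)
      show "P \<inter> Z = {}" by (auto simp: P_def Z_def)
    qed (use F in \<open>auto simp: P_def Z_def\<close>)
    then obtain k where k: "\<forall>n\<in>P. k + n \<notin> multiples B" "\<forall>n\<in>Z. k + n \<in> multiples B" by blast
    have "coding B (window B) (Delta B k) n = x n" if "n \<in> F" for n
    proof (cases "x n = 1")
      case True
      then have "k + n \<notin> multiples B" using k(1) that by (simp add: P_def)
      then show ?thesis using True by (simp add: coding_def Delta_add Delta_in_window_iff)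
    next
      case False
      then have "x n = 0" using x01 [of n] by simp
      then have "k + n \<in> multiples B" using k(2) that by (simp add: Z_def)
      then show ?thesis using \<open>x n = 0\<close> by (simp add: coding_def Delta_add Delta_in_window_iff)
    qed
    then show ?thesis by (intro bexI [of _ "coding B (window B) (Delta B k)"]) simp_all
  qed
  moreover have "coding B (window B) ` range (Delta B) \<subseteq> PiE UNIV (\<lambda>_. {0, 1})"
    by (rule image_subsetI) (rule coding_in_full_shift)
  ultimately show "x \<in> X_eta B"
    unfolding X_eta_def full_shift_def using x by (simp add: in_closure_of_discrete_product)
qed

lemma coding_odometer_subset_interval:
  "coding B (window B) ` odometer B \<subseteq> coding_interval B"
proof
  fix x assume "x \<in> coding B (window B) ` odometer B"
  then obtain h where h: "h \<in> odometer B" "x = coding B (window B) h" by blast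
  have "coding B (window' B) h \<le> x"
    using subsetD [OF window'_subset_window] by (simp add: h(2) coding_def le_fun_def)
  moreover have "x \<in> topspace full_shift"
    using coding_in_full_shift [of "window B" h] by (simp add: h(2) full_shift_def)
  ultimately show "x \<in> coding_interval B"
    using h unfolding coding_interval_def by blast
qed

end

section \<open>Primitivity and equality of the closures\<close>

lemma taut_imp_primitive:
  assumes "taut B"
  shows "primitive_set B"
  unfolding primitive_set_def
proof (intro notI, elim bexE conjE)
  fix b b' assume b: "b \<in> B" "b' \<in> B" "b \<noteq> b'" "b dvd b'"
  have "multiples (B - {b'}) = multiples B"
  proof (rule subset_antisym; rule subsetI)
    fix n assume "n \<in> multiples B"
    then obtain c where c: "c \<in> B" "int c dvd n" by (auto simp: in_multiples_iff)
    show "n \<in> multiples (B - {b'})"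
    proof (cases "c = b'")
      case True
      then have "int b dvd n" using b(4) c(2) by (meson dvd_trans int_dvd_int_iff)
      then show ?thesis using b by (auto simp: in_multiples_iff)
    qed (use c in \<open>auto simp: in_multiples_iff\<close>)
  qed (auto simp: in_multiples_iff)
  then show False using assms b(2) by (metis less_irrefl taut_def)
qed

theorem corollary2:
  fixes B :: "nat set"
  assumes "B \<subseteq> {1..}" and "B \<noteq> {}" and "taut B"
  shows "primitive_set B \<and> X_eta B = X_phi B \<and>
         X_phi B = full_shift closure_of coding_interval B"
proof -
  have "0 \<notin> B" using assms(1) by auto
  then have "range (Delta B) \<subseteq> odometer B" using Delta_in_odometer by blast
  then have eta_phi: "X_eta B \<subseteq> X_phi B"
    unfolding X_eta_def X_phi_def by (intro closure_of_mono image_mono)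
  have phi_interval: "X_phi B \<subseteq> full_shift closure_of coding_interval B"
    unfolding X_phi_def using assms(1) by (intro closure_of_mono coding_odometer_subset_interval)
  have "full_shift closure_of coding_interval B \<subseteq> X_eta B"
    using coding_interval_subset_X_eta [OF assms(1,3)] by (rule closure_of_minimal) (simp add: X_eta_def)
  then show ?thesis using taut_imp_primitive [OF assms(3)] eta_phi phi_interval by blast
qed

end
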